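(* Fix an integer $p\ge2$. If $(\beta_1,\beta_2)$ is off the phase transition curve, then $$\lim_{n\to\infty}\frac{\partial^2}{\partial\beta_1^2}\psi_n(\beta_1,\beta_2)=\frac{\partial^2}{\partial\beta_1^2}\lim_{n\to\infty}\psi_n(\beta_1,\beta_2)=\frac{1}{|\ell''(x^* )|}.$$ If $(\beta_1,\beta_2)$ is on the phase transition curve but is not the critical point, then $$\lim_{n\to\infty}\frac1n\frac{\partial^2}{\partial\beta_1^2}\psi_n(\beta_1,\beta_2)=\frac{(x_1^*-x_2^* )^2\sqrt{x_1^*(1-x_1^* )|\ell''(x_1^* )|}\sqrt{x_2^*(1-x_2^* )|\ell''(x_2^* )|}}{\left(\sqrt{x_1^*(1-x_1^* )|\ell''(x_1^* )|}+\sqrt{x_2^*(1-x_2^* )|\ell''(x_2^* )|}\right)^2}.$$ At the critical point $(\beta_1,\beta_2)=(\beta_1^c,\beta_2^c)$, $$\lim_{n\to\infty}\frac{1}{n^{1/2}}\frac{\partial^2}{\partial\beta_1^2}\psi_n(\beta_1,\beta_2)=\frac{\Gamma(\frac34)}{\Gamma(\frac14)}\frac{2\sqrt6(p-1)}{p^{5/2}}.$$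
   Context: For $n\ge 1$, a directed graph (loops allowed, no duplicate edges) on $n$ nodes is identified with its adjacency matrix $X=(X_{ij})_{1\le i,j\le n}\in\{0,1\}^{n\times n}$. Set $$e(X)=n^{-2}\sum_{1\le i,j\le n}X_{ij},\qquad s(X)=n^{-p-1}\sum_{1\le i,j_1,\dots,j_p\le n}X_{ij_1}X_{ij_2}\cdots X_{ij_p}.$$ For real $\beta_1,\beta_2$, $Z_n(\beta_1,\beta_2)=\sum_{X\in\{0,1\}^{n\times n}}\exp[n^2(\beta_1e(X)+\beta_2s(X))]$ and $\psi_n(\beta_1,\beta_2)=n^{-2}\log Z_n(\beta_1,\beta_2)$. The function $\ell:[0,1]\to\mathbb{R}$ is $\ell(x)=\beta_1x+\beta_2x^p-x\log x-(1-x)\log(1-x)$ (with $0\log0=0$); $\ell''$ is its second derivative in $x$. Phase transition curve: by a known result of Radin and Yin there is a curve in the $(\beta_1,\beta_2)$-plane, of the form $\beta_2=q(\beta_1)$ for $\beta_1\le\beta_1^c$, with endpoint (the critical point) $$(\beta_1^c,\beta_2^c)=\left(\log(p-1)-\frac{p}{p-1},\ \frac{p^{p-1}}{(p-1)^p}\right),$$ such that off the curve and at the endpoint $\ell$ has a unique global maximizer $x^*\in(0,1)$, while on the curve away from the endpoint $\ell$ has exactly two global maximizers $x_1^*,x_2^*$, with $0<x_1^*<\frac{p-1}{p}<x_2^*<1$. The critical point belongs to the curve, so "off the curve" excludes it. *)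

theory Defs
  imports "HOL-Analysis.Analysis"
begin

text \<open>Directed graphs on the nodes 1, ..., n (loops allowed), as 0/1 adjacency matrices.\<close>

definition digraphs :: "nat \<Rightarrow> (nat \<times> nat \<Rightarrow> real) set" where
  "digraphs n = ({1..n} \<times> {1..n}) \<rightarrow>\<^sub>E {0, 1}"

definition edge_density :: "nat \<Rightarrow> (nat \<times> nat \<Rightarrow> real) \<Rightarrow> real" where
  "edge_density n X = (\<Sum>i\<in>{1..n}. \<Sum>j\<in>{1..n}. X (i, j)) / real n ^ 2"

definition star_density :: "nat \<Rightarrow> nat \<Rightarrow> (nat \<times> nat \<Rightarrow> real) \<Rightarrow> real" where
  "star_density p n X =
     (\<Sum>i\<in>{1..n}. \<Sum>j\<in>{1..p} \<rightarrow>\<^sub>E {1..n}. \<Prod>k\<in>{1..p}. X (i, j k)) / real n ^ (p + 1)"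

definition Z :: "nat \<Rightarrow> nat \<Rightarrow> real \<Rightarrow> real \<Rightarrow> real" where
  "Z p n \<beta>1 \<beta>2 =
     (\<Sum>X\<in>digraphs n. exp (real n ^ 2 * (\<beta>1 * edge_density n X + \<beta>2 * star_density p n X)))"

definition psi :: "nat \<Rightarrow> nat \<Rightarrow> real \<Rightarrow> real \<Rightarrow> real" where
  "psi p n \<beta>1 \<beta>2 = ln (Z p n \<beta>1 \<beta>2) / real n ^ 2"

text \<open>Only used on the unit interval; the convention \<open>0 * ln 0 = 0\<close> holds automatically.\<close>

definition ell :: "nat \<Rightarrow> real \<Rightarrow> real \<Rightarrow> real \<Rightarrow> real" where
  "ell p \<beta>1 \<beta>2 x = \<beta>1 * x + \<beta>2 * x ^ p - x * ln x - (1 - x) * ln (1 - x)"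

definition ell'' :: "nat \<Rightarrow> real \<Rightarrow> real \<Rightarrow> real \<Rightarrow> real" where
  "ell'' p \<beta>1 \<beta>2 = deriv (deriv (ell p \<beta>1 \<beta>2))"

definition maximizers :: "nat \<Rightarrow> real \<Rightarrow> real \<Rightarrow> real set" where
  "maximizers p \<beta>1 \<beta>2 = {x. is_arg_max (ell p \<beta>1 \<beta>2) (\<lambda>y. y \<in> {0..1}) x}"

definition \<beta>1c :: "nat \<Rightarrow> real" where
  "\<beta>1c p = ln (real p - 1) - real p / (real p - 1)"

definition \<beta>2c :: "nat \<Rightarrow> real" where
  "\<beta>2c p = real p ^ (p - 1) / (real p - 1) ^ p"

text \<open>
  The phase transition curve is the graph of \<open>q p\<close> over \<open>{..\<beta>1c p}\<close>. For \<open>\<beta>1 < \<beta>1c p\<close> the value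
  \<open>q p \<beta>1\<close> is the only \<open>\<beta>2\<close> at which \<open>ell\<close> has exactly two global maximizers; existence and
  uniqueness of this value is the theorem of Radin and Yin. At the endpoint, where the maximizer
  is unique, the value is prescribed.
\<close>

definition q :: "nat \<Rightarrow> real \<Rightarrow> real" where
  "q p \<beta>1 = (if \<beta>1 = \<beta>1c p then \<beta>2c p else (THE \<beta>2. card (maximizers p \<beta>1 \<beta>2) = 2))"

definition phase_curve :: "nat \<Rightarrow> (real \<times> real) set" where
  "phase_curve p = {(\<beta>1, \<beta>2). \<beta>1 \<le> \<beta>1c p \<and> \<beta>2 = q p \<beta>1}"

text \<open>
  \<open>deriv\<close> is total and returns an unspecified value where no derivative exists. This relation
  asserts in addition that \<open>f\<close> is differentiable near \<open>x\<close> and twice differentiable at \<open>x\<close>.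
\<close>

definition has_second_derivative :: "(real \<Rightarrow> real) \<Rightarrow> real \<Rightarrow> real \<Rightarrow> bool" where
  "has_second_derivative f D x \<longleftrightarrow>
     (\<exists>f'. (\<forall>\<^sub>F y in nhds x. (f has_real_derivative f' y) (at y)) \<and>
           (f' has_real_derivative D) (at x))"

text \<open>The second partial derivative of \<open>psi p n\<close> in its first parameter (\<open>psi p n\<close> is smooth).\<close>

definition d2psi :: "nat \<Rightarrow> nat \<Rightarrow> real \<Rightarrow> real \<Rightarrow> real" where
  "d2psi p n \<beta>1 \<beta>2 = deriv (deriv (\<lambda>b. psi p n b \<beta>2)) \<beta>1"

end

theory Submission
  imports Defs "HOL-Probability.Probability" "HOL-Real_Asymp.Real_Asymp"
begin

text \<open>
  The rows of the adjacency matrix are independent and weighted by their sums only, so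
  \<open>Z = W ^ n\<close> with \<open>W = (\<Sum>k\<le>n. (n choose k) * exp (\<beta>1 * k + \<beta>2 * n * (k / n) ^ p))\<close>, and the second
  derivative of \<open>psi\<close> is the variance of \<open>k\<close> under these weights, divided by \<open>n\<close>. By Stirling's formula
  the weight of \<open>k\<close> is asymptotically \<open>exp (n * ell (k / n)) / sqrt (2 * pi * n * x * (1 - x))\<close> with
  \<open>x = k / n\<close>, so Laplace's method applies: near a maximizer \<open>x\<close> where \<open>ell\<close> drops like \<open>c * (y - x) ^ m\<close>,
  the weights on the scale \<open>n powr (1 - 1 / m)\<close> approach the density \<open>exp (- c * y ^ m)\<close>. Here \<open>m = 2\<close>
  except at the critical point, where \<open>m = 4\<close>; two maximizers yield a two-point mixture.
\<close>

section \<open>Reduction to a single row\<close>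

text \<open>At two maximizers the exponential factors agree exactly, so the mixture weights come
  entirely from the Stirling prefactor \<open>1 / sqrt (x * (1 - x))\<close> and from the widths of
  the two peaks; estimates on the exponential scale alone would lose them. The phase curve is given
  by a definite description, so existence and uniqueness of the transition value have to be
  established before the case distinction means anything. Everything there rests on one fact:
  \<open>x ^ (p - 1) * (1 - x)\<close> rises up to \<open>(p - 1) / p\<close> and falls afterwards.
  The same fact excludes degenerate maximizers away from the critical point. Convergence of
  \<open>psi\<close> does not by itself carry over to second derivatives. Off the curve the limit of
  the derivatives and the derivative of the limit are therefore computed independently and found to
  be equal.\<close>

lemma sum_indicator_functions:
  fixes h :: "real \<Rightarrow> real"
  assumes "finite A"
  shows "(\<Sum>r\<in>A \<rightarrow>\<^sub>E {0, 1}. h (\<Sum>j\<in>A. r j)) = (\<Sum>k\<le>card A. real (card A choose k) * h (real k))"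
proof -
  have "(\<Sum>r\<in>A \<rightarrow>\<^sub>E {0, 1}. h (\<Sum>j\<in>A. r j)) = (\<Sum>S\<in>Pow A. h (real (card S)))"
  \<comment> \<open>A row is identified with the set of columns where it equals 1;
    \<open>restrict\<close> supplies the value \<open>undefined\<close> outside \<open>A\<close>
    that the extensional space demands.\<close>
  proof (rule sum.reindex_bij_witness[where i = "\<lambda>S. restrict (indicator S) A" and j = "\<lambda>r. {j\<in>A. r j = 1}"])
    fix r :: "'a \<Rightarrow> real" assume r: "r \<in> A \<rightarrow>\<^sub>E {0, 1}"
    show "restrict (indicator {j \<in> A. r j = 1}) A = r"
    proof
      fix x show "restrict (indicator {j \<in> A. r j = 1}) A x = r x"
        using r by (cases "x \<in> A") (auto simp: indicator_def PiE_def extensional_def)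
    qed
    have "(\<Sum>j\<in>A. r j) = (\<Sum>j\<in>A. if r j = 1 then 1 else 0)"
      using r by (intro sum.cong) auto
    also have "\<dots> = real (card {j \<in> A. r j = 1})"
      using assms by (simp add: sum.If_cases Int_def)
    finally show "h (real (card {j \<in> A. r j = 1})) = h (\<Sum>j\<in>A. r j)" by simp
  next
    fix S assume "S \<in> Pow A"
    then show "{j \<in> A. restrict (indicator S) A j = (1::real)} = S"
      by (auto simp: indicator_def)
  qed (auto simp: indicator_def)
  also have "\<dots> = (\<Sum>k\<le>card A. \<Sum>S\<in>{S \<in> Pow A. card S = k}. h (real (card S)))"
    using assms by (intro sum.group[symmetric]) (auto intro: card_mono)
  also have "\<dots> = (\<Sum>k\<le>card A. real (card A choose k) * h (real k))"
    using assms by (intro sum.cong) (auto simp: n_subsets)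
  finally show ?thesis .
qed

text \<open>Distributivity expands the power into a sum over all choices of one row per index, and
  currying identifies these choices with matrices.\<close>

lemma sum_PiE_Times:
  assumes "finite A" "finite B" "finite C"
  shows "(\<Sum>X\<in>(A \<times> B) \<rightarrow>\<^sub>E C. \<Prod>i\<in>A. f (\<lambda>j\<in>B. X (i, j))) = (\<Sum>r\<in>B \<rightarrow>\<^sub>E C. f r :: real) ^ card A"
proof -
  have "(\<Sum>r\<in>B \<rightarrow>\<^sub>E C. f r) ^ card A = (\<Prod>i\<in>A. \<Sum>r\<in>B \<rightarrow>\<^sub>E C. f r)"
    by simp
  also have "\<dots> = (\<Sum>g\<in>A \<rightarrow>\<^sub>E (B \<rightarrow>\<^sub>E C). \<Prod>i\<in>A. f (g i))"
    using assms by (intro prod_sum_PiE) (auto intro: finite_PiE)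
  also have "\<dots> = (\<Sum>X\<in>(A \<times> B) \<rightarrow>\<^sub>E C. \<Prod>i\<in>A. f (\<lambda>j\<in>B. X (i, j)))"
  proof -
    \<comment> \<open>\<open>I\<close> curries and \<open>J\<close> uncurries; the restrictions fix
      the values outside the index sets, which makes the two maps mutually inverse.\<close>
    define I where "I X = (\<lambda>i\<in>A. \<lambda>j\<in>B. X (i, j))" for X :: "'a \<times> 'b \<Rightarrow> 'c"
    define J where "J g = (\<lambda>x\<in>A \<times> B. g (fst x) (snd x))" for g :: "'a \<Rightarrow> 'b \<Rightarrow> 'c"
    have row: "(\<lambda>j\<in>B. J g (i, j)) = g i" if "g \<in> A \<rightarrow>\<^sub>E (B \<rightarrow>\<^sub>E C)" "i \<in> A" for g i
      using that by (intro ext) (auto simp: J_def PiE_def extensional_def Pi_def)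
    have IJ: "I (J g) = g" if "g \<in> A \<rightarrow>\<^sub>E (B \<rightarrow>\<^sub>E C)" for g
      using that row[OF that] by (intro ext) (auto simp: I_def PiE_def extensional_def)
    have JI: "J (I X) = X" if "X \<in> (A \<times> B) \<rightarrow>\<^sub>E C" for X
      using that by (intro ext) (auto simp: I_def J_def PiE_def extensional_def)
    have J: "J g \<in> (A \<times> B) \<rightarrow>\<^sub>E C" if "g \<in> A \<rightarrow>\<^sub>E (B \<rightarrow>\<^sub>E C)" for g
      using that by (auto simp: J_def PiE_def Pi_def)
    have I: "I X \<in> A \<rightarrow>\<^sub>E (B \<rightarrow>\<^sub>E C)" if "X \<in> (A \<times> B) \<rightarrow>\<^sub>E C" for X
      using that by (auto simp: I_def PiE_def Pi_def)
    have "bij_betw J (A \<rightarrow>\<^sub>E (B \<rightarrow>\<^sub>E C)) ((A \<times> B) \<rightarrow>\<^sub>E C)"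
      by (rule bij_betw_byWitness[where f' = I]) (intro ballI image_subsetI IJ JI I J; assumption)+
    from sum.reindex_bij_betw[OF this, of "\<lambda>X. \<Prod>i\<in>A. f (\<lambda>j\<in>B. X (i, j))", symmetric]
    show ?thesis
      using row by (simp cong: sum.cong prod.cong)
  qed
  finally show ?thesis ..
qed

definition wt :: "nat \<Rightarrow> nat \<Rightarrow> real \<Rightarrow> real \<Rightarrow> nat \<Rightarrow> real" where
  "wt p n b1 b2 k = real (n choose k) * exp (b1 * real k + b2 * real n * (real k / real n) ^ p)"

definition W :: "nat \<Rightarrow> nat \<Rightarrow> real \<Rightarrow> real \<Rightarrow> real" where
  "W p n b1 b2 = (\<Sum>k\<le>n. wt p n b1 b2 k)"

lemma wt_nonneg: "wt p n b1 b2 k \<ge> 0"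
  by (simp add: wt_def)

lemma wt_pos: "k \<le> n \<Longrightarrow> wt p n b1 b2 k > 0"
  by (simp add: wt_def)

lemma W_pos: "W p n b1 b2 > 0"
  unfolding W_def by (intro sum_pos) (auto simp: wt_pos)

text \<open>The p-th power of a row sum expands into the stars centred at that row, so distinct rows
  do not interact. The normalisation \<open>n ^ 2 / n ^ (p + 1)\<close> leaves one factor
  \<open>n\<close> beside the p-th power of a row average.\<close>

lemma star_density_rows:
  assumes "n > 0"
  shows "real n ^ 2 * star_density p n X = (\<Sum>i\<in>{1..n}. real n * ((\<Sum>j\<in>{1..n}. X (i, j)) / real n) ^ p)"
proof -
  have "(\<Sum>j\<in>{1..p} \<rightarrow>\<^sub>E {1..n}. \<Prod>k\<in>{1..p}. X (i, j k)) = (\<Sum>j\<in>{1..n}. X (i, j)) ^ p" for i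
    using prod_sum_PiE[of "{1..p}" "\<lambda>_. {1..n}" "\<lambda>_ j. X (i, j)"] by simp
  then show ?thesis
    using assms unfolding star_density_def
    by (simp only: sum_divide_distrib[symmetric] sum_distrib_left[symmetric] power_divide)
       (simp add: power2_eq_square)
qed

lemma Z_eq_W_power:
  assumes "n > 0"
  shows "Z p n b1 b2 = W p n b1 b2 ^ n"
proof -
  define f where "f s = exp (b1 * s + b2 * (real n * (s / real n) ^ p))" for s
  have e: "real n ^ 2 * edge_density n X = (\<Sum>i\<in>{1..n}. \<Sum>j\<in>{1..n}. X (i, j))" for X
    using assms by (simp add: edge_density_def)
  \<comment> \<open>The restriction leaves the row sum unchanged; it gives the summand the shape of
    \<open>sum_PiE_Times\<close>, where a factor sees its row as an extensional function.\<close>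
  have "exp (real n ^ 2 * (b1 * edge_density n X + b2 * star_density p n X))
        = (\<Prod>i\<in>{1..n}. f (\<Sum>j\<in>{1..n}. (\<lambda>j\<in>{1..n}. X (i, j)) j))" for X
  proof -
    have "real n ^ 2 * (b1 * edge_density n X + b2 * star_density p n X)
       = b1 * (real n ^ 2 * edge_density n X) + b2 * (real n ^ 2 * star_density p n X)"
      by (simp add: algebra_simps)
    also have "\<dots> = (\<Sum>i\<in>{1..n}. b1 * (\<Sum>j\<in>{1..n}. X (i, j))
                       + b2 * (real n * ((\<Sum>j\<in>{1..n}. X (i, j)) / real n) ^ p))"
      unfolding e star_density_rows[OF assms] by (simp add: sum.distrib sum_distrib_left)
    finally show ?thesis by (simp add: exp_sum f_def)
  qed
  then have "Z p n b1 b2 = (\<Sum>X\<in>({1..n} \<times> {1..n}) \<rightarrow>\<^sub>E {0, 1}.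
      \<Prod>i\<in>{1..n}. (\<lambda>r. f (\<Sum>j\<in>{1..n}. r j)) (\<lambda>j\<in>{1..n}. X (i, j)))"
    by (simp add: Z_def digraphs_def)
  also have "\<dots> = (\<Sum>r\<in>{1..n} \<rightarrow>\<^sub>E {0, 1}. f (\<Sum>j\<in>{1..n}. r j)) ^ card {1..n}"
    by (rule sum_PiE_Times) auto
  also have "\<dots> = W p n b1 b2 ^ n"
    by (subst sum_indicator_functions) (simp_all add: W_def wt_def f_def algebra_simps)
  finally show ?thesis .
qed

lemma psi_eq_ln_W:
  assumes "n > 0"
  shows "psi p n b1 b2 = ln (W p n b1 b2) / real n"
  using assms by (simp add: psi_def Z_eq_W_power ln_realpow W_pos power2_eq_square)

section \<open>The second derivative of the free energy as a variance\<close>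

definition moment :: "nat \<Rightarrow> nat \<Rightarrow> real \<Rightarrow> real \<Rightarrow> real \<Rightarrow> nat \<Rightarrow> real" where
  "moment p n b1 b2 a j = (\<Sum>k\<le>n. wt p n b1 b2 k * (real k - a) ^ j)"

lemma moment_0: "moment p n b1 b2 a 0 = W p n b1 b2"
  by (simp add: moment_def W_def)

lemma moment_shift:
  "moment p n b1 b2 a 1 = moment p n b1 b2 0 1 - a * W p n b1 b2"
  "moment p n b1 b2 a 2 = moment p n b1 b2 0 2 - 2 * a * moment p n b1 b2 0 1 + a\<^sup>2 * W p n b1 b2"
  by (simp_all add: moment_def W_def sum_distrib_left sum_subtractf[symmetric] sum.distrib[symmetric]
        power2_eq_square algebra_simps)

text \<open>Each derivative in \<beta>1 brings down a factor \<open>k\<close>. This raises the order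
  of a moment only for the centre 0; \<open>moment_shift\<close> passes to other centres.\<close>

lemma has_derivative_moment:
  "((\<lambda>b. moment p n b b2 0 j) has_real_derivative moment p n b1 b2 0 (Suc j)) (at b1)"
  unfolding moment_def wt_def
  by (auto intro!: derivative_eq_intros sum.cong simp: algebra_simps)

text \<open>As a function of \<beta>1, \<open>ln W\<close> is a cumulant generating function, so its
  second derivative is a variance. A variance is translation invariant; the free centre
  \<open>a\<close> is later placed at \<open>n\<close> times a maximizer, so that moments are
  measured from a peak.\<close>

lemma d2psi_eq_variance:
  assumes "n > 0"
  shows "d2psi p n b1 b2 = (moment p n b1 b2 a 2 / W p n b1 b2 - (moment p n b1 b2 a 1 / W p n b1 b2)\<^sup>2) / real n"
proof -
  let ?m = "\<lambda>j b. moment p n b b2 0 j"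
  have W: "((\<lambda>b. W p n b b2) has_real_derivative ?m 1 b) (at b)" for b
    using has_derivative_moment[of p n b2 0 b] by (simp add: moment_0)
  have "deriv (\<lambda>b. psi p n b b2) = (\<lambda>b. ?m 1 b / W p n b b2 / real n)"
    unfolding psi_eq_ln_W[OF assms]
    by (intro ext DERIV_imp_deriv)
       (use W_pos assms in \<open>auto intro!: derivative_eq_intros W simp: field_simps\<close>)
  moreover have "((\<lambda>b. ?m 1 b / W p n b b2 / real n) has_real_derivative
       (?m 2 b1 / W p n b1 b2 - (?m 1 b1 / W p n b1 b2)\<^sup>2) / real n) (at b1)"
    using W_pos[of p n b1 b2] assms has_derivative_moment[of p n b2 1 b1]
    by (auto intro!: derivative_eq_intros W simp: field_simps power2_eq_square numeral_2_eq_2)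
  ultimately have "d2psi p n b1 b2 = (?m 2 b1 / W p n b1 b2 - (?m 1 b1 / W p n b1 b2)\<^sup>2) / real n"
    unfolding d2psi_def by (simp add: DERIV_imp_deriv)
  also have "\<dots> = (moment p n b1 b2 a 2 / W p n b1 b2 - (moment p n b1 b2 a 1 / W p n b1 b2)\<^sup>2) / real n"
    using W_pos[of p n b1 b2] assms unfolding moment_shift[of p n b1 b2 a] 
    by (simp add: field_simps power2_eq_square)
  finally show ?thesis .
qed

section \<open>Stirling's formula and the row weights\<close>

definition stirling_ratio :: "nat \<Rightarrow> real" where
  "stirling_ratio n = fact n / (sqrt (real n) * (real n / exp 1) ^ n)"

lemma stirling_ratio_pos: "n > 0 \<Longrightarrow> stirling_ratio n > 0"
  by (simp add: stirling_ratio_def)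

text \<open>The value of the limit (it is \<open>sqrt (2 * pi)\<close>) cancels in every quotient below.\<close>

lemma stirling_ratio_tendsto:
  "\<exists>C>0. stirling_ratio \<longlonglongrightarrow> C"
proof -
  let ?r = stirling_ratio
  define d where "d n = ln (?r (Suc n))" for n
  have rpos: "?r (Suc n) > 0" for n by (simp add: stirling_ratio_def)
  have dn: "d n = ln (fact (Suc n)) - (real n + 3/2) * ln (real n + 1) + (real n + 1)" for n
  proof -
    have "ln (sqrt (real (Suc n)) * (real (Suc n) / exp 1) ^ Suc n)
        = ln (real n + 1) / 2 + (real n + 1) * (ln (real n + 1) - 1)"
      by (subst ln_mult) (auto simp: ln_sqrt ln_realpow ln_div add_ac simp del: power_Suc)
    then show ?thesis
      by (simp add: d_def stirling_ratio_def ln_div algebra_simps del: fact_Suc power_Suc)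
  qed
  have diff: "d (Suc n) - d n = 1 - (real n + 3/2) * ln ((real n + 2) / (real n + 1))" for n
  proof -
    have "ln (fact (Suc (Suc n)) :: real) = ln (real n + 2) + ln (fact (Suc n))"
      by (subst fact_Suc, subst ln_mult) (auto simp: add_ac simp del: fact_Suc)
    then show ?thesis
      by (simp add: dn ln_div algebra_simps del: fact_Suc)
  qed
  \<comment> \<open>With \<open>N = n + 1\<close> one has
    \<open>(N + 1/2) * ln (1 + 1 / N) = 1 + O(1 / N^2)\<close>: the half contributed by the square
    root cancels the term of order \<open>1 / N\<close>, which makes the increments
    summable.\<close>
  have "(\<lambda>n. 1 - (real n + 3/2) * ln ((real n + 2) / (real n + 1))) \<in> O(\<lambda>n. inverse (real n ^ 2))"
    by real_asymp
  then have "summable (\<lambda>n. d (Suc n) - d n)"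
    unfolding diff
    by (rule summable_comparison_test_bigo[rotated]) (use inverse_power_summable[of 2, where 'a=real] in auto)
  then have "convergent (\<lambda>n. \<Sum>k<n. d (Suc k) - d k)"
    by (simp add: summable_iff_convergent)
  then obtain L' where "(\<lambda>n. d n - d 0) \<longlonglongrightarrow> L'"
    unfolding sum_lessThan_telescope by (auto simp: convergent_def)
  from tendsto_add[OF this tendsto_const[of "d 0"]] obtain L where "d \<longlonglongrightarrow> L" by auto
  then have "(\<lambda>n. exp (d n)) \<longlonglongrightarrow> exp L" by (rule tendsto_exp)
  then have "(\<lambda>n. ?r (Suc n)) \<longlonglongrightarrow> exp L" using rpos by (simp add: d_def)
  then have "?r \<longlonglongrightarrow> exp L" by (rule LIMSEQ_imp_Suc)
  then show ?thesis by (intro exI[of _ "exp L"]) simp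
qed

definition stirling_const :: real where "stirling_const = lim stirling_ratio"

lemma stirling_const: "stirling_const > 0" "stirling_ratio \<longlonglongrightarrow> stirling_const"
  using stirling_ratio_tendsto by (auto simp: stirling_const_def limI)

text \<open>Convergence to a positive limit bounds the ratios and their reciprocals; at index 0 both
  are 0 because of division by zero. The bounds dominate the prefactors in Laplace's method and
  bound them below for the free energy.\<close>

lemma stirling_ratio_bounded:
  obtains B where "B > 0" "\<And>n. stirling_ratio n \<le> B" "\<And>n. 1 / stirling_ratio n \<le> B"
proof -
  have "(\<lambda>n. 1 / stirling_ratio n) \<longlonglongrightarrow> 1 / stirling_const"
    using stirling_const by (intro tendsto_intros) auto
  then obtain K2 where "\<And>n. norm (1 / stirling_ratio n) \<le> K2"
    by (meson BseqE convergentI convergent_imp_Bseq)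
  moreover obtain K1 where "K1 > 0" "\<And>n. norm (stirling_ratio n) \<le> K1"
    by (meson BseqE convergentI convergent_imp_Bseq stirling_const(2))
  ultimately show ?thesis
    by (intro that[of "max K1 K2"]) (auto simp: le_max_iff_disj intro: order_trans[OF abs_ge_self])
qed

lemma exp_entropy:
  assumes "0 < k" "k < n"
  shows "exp (real n * (- (real k / real n) * ln (real k / real n) - (1 - real k / real n) * ln (1 - real k / real n)))
         = real n ^ n / (real k ^ k * real (n - k) ^ (n - k))"
proof -
  have "1 - real k / real n = real (n - k) / real n"
    using assms by (simp add: field_simps of_nat_diff)
  then have "real n * (- (real k / real n) * ln (real k / real n) - (1 - real k / real n) * ln (1 - real k / real n))
        = - real k * ln (real k / real n) - real (n - k) * ln (real (n - k) / real n)"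
    using assms by (simp add: field_simps)
  also have "\<dots> = real n * ln (real n) - real k * ln (real k) - real (n - k) * ln (real (n - k))"
    using assms by (simp add: ln_div of_nat_diff algebra_simps)
  finally show ?thesis
    using assms by (simp add: exp_diff exp_of_nat_mult del: of_nat_diff)
qed

text \<open>An identity without error term: every deviation from Stirling's formula sits in the
  three ratios, which are bounded throughout and converge once \<open>k\<close> and
  \<open>n - k\<close> tend to infinity. The factors \<open>exp 1\<close> cancel since
  \<open>k + (n - k) = n\<close>.\<close>

lemma wt_eq_stirling:
  assumes "0 < k" "k < n"
  defines "x \<equiv> real k / real n"
  shows "wt p n b1 b2 k = stirling_ratio n / (stirling_ratio k * stirling_ratio (n - k))
           / sqrt (real n * x * (1 - x)) * exp (real n * ell p b1 b2 x)"
proof -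
  have "real (n choose k) = fact n / (fact k * fact (n - k))"
    using assms by (simp add: binomial_fact)
  also have "\<dots> = stirling_ratio n / (stirling_ratio k * stirling_ratio (n - k))
      * (sqrt (real n) / (sqrt (real k) * sqrt (real (n - k))))
      * ((real n / exp 1) ^ n / ((real k / exp 1) ^ k * (real (n - k) / exp 1) ^ (n - k)))"
    using assms by (simp add: stirling_ratio_def)
  also have "(real n / exp 1) ^ n / ((real k / exp 1) ^ k * (real (n - k) / exp 1) ^ (n - k))
      = real n ^ n / (real k ^ k * real (n - k) ^ (n - k))"
  proof -
    have "exp 1 ^ n = exp 1 ^ k * (exp 1 ^ (n - k) :: real)"
      using assms by (simp flip: power_add)
    then show ?thesis by (simp add: power_divide)
  qed
  also have "\<dots> = exp (real n * (- x * ln x - (1 - x) * ln (1 - x)))"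
    using exp_entropy[OF assms(1,2)] by (simp add: x_def)
  also have "sqrt (real n) / (sqrt (real k) * sqrt (real (n - k))) = 1 / sqrt (real n * x * (1 - x))"
    using assms by (simp add: real_sqrt_mult[symmetric] real_sqrt_divide[symmetric] field_simps of_nat_diff)
  finally show ?thesis
    using assms by (simp add: wt_def ell_def field_simps flip: exp_add)
qed

text \<open>A single term of the binomial distribution with success probability \<open>k / n\<close>
  is at most 1. The resulting bound has no prefactor and extends to the endpoints, where the
  Stirling form breaks down, so it controls the tails uniformly.\<close>

lemma wt_le_exp:
  assumes "k \<le> n" "n > 0"
  shows "wt p n b1 b2 k \<le> exp (real n * ell p b1 b2 (real k / real n))"
proof (cases "k = 0 \<or> k = n")
  case True
  \<comment> \<open>At the endpoints the entropy vanishes by \<open>0 * ln 0 = 0\<close>, the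
    binomial coefficient is 1, and both sides agree.\<close>
  then show ?thesis using assms by (auto simp: wt_def ell_def algebra_simps)
next
  case False
  then have k: "0 < k" "k < n" using assms by auto
  define x where "x = real k / real n"
  have "real (n choose k) * x ^ k * (1 - x) ^ (n - k) \<le> (\<Sum>k\<le>n. real (n choose k) * x ^ k * (1 - x) ^ (n - k))"
    using k by (intro member_le_sum) (auto simp: x_def)
  also have "\<dots> = 1"
    using binomial_ring[of x "1 - x" n] by simp
  also have "x ^ k = real k ^ k / real n ^ k" by (simp add: x_def power_divide)
  also have "(1 - x) ^ (n - k) = real (n - k) ^ (n - k) / real n ^ (n - k)"
    using k by (simp add: x_def of_nat_diff diff_divide_distrib flip: power_divide)
  finally have "real (n choose k) * (real k ^ k * real (n - k) ^ (n - k)) \<le> real n ^ k * real n ^ (n - k)"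
    using k by (simp add: field_simps)
  then have "real (n choose k) \<le> real n ^ n / (real k ^ k * real (n - k) ^ (n - k))"
    using k by (simp add: field_simps flip: power_add)
  also have "\<dots> = exp (real n * (- x * ln x - (1 - x) * ln (1 - x)))"
    using exp_entropy[OF k] by (simp add: x_def)
  finally have "wt p n b1 b2 k \<le> exp (real n * (- x * ln x - (1 - x) * ln (1 - x))) * exp (b1 * real k + b2 * real n * x ^ p)"
    unfolding wt_def x_def by (intro mult_right_mono) auto
  also have "\<dots> = exp (real n * ell p b1 b2 x)"
    using k by (simp add: ell_def x_def algebra_simps flip: exp_add)
  finally show ?thesis by (simp add: x_def)
qed

section \<open>Laplace's method\<close>

text \<open>The integrand equals \<open>F k\<close> on an interval of length \<open>1 / s\<close>,
  so the scaled sum is an integral exactly, with no discretisation error.\<close>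

lemma has_bochner_integral_floor:
  fixes F :: "int \<Rightarrow> real"
  assumes "finite K" "\<And>k. k \<notin> K \<Longrightarrow> F k = 0" "s > 0"
  shows "has_bochner_integral lborel (\<lambda>y. F \<lfloor>a + s * y\<rfloor>) ((\<Sum>k\<in>K. F k) / s)"
proof -
  have "has_bochner_integral lborel (\<lambda>y. F k * indicator {(real_of_int k - a) / s..<(real_of_int k + 1 - a) / s} y) (F k * (1 / s))" for k
  proof -
    have "measure lborel {(real_of_int k - a) / s..<(real_of_int k + 1 - a) / s} = 1 / s"
      using assms by (subst measure_lborel_Ico) (auto simp: divide_right_mono diff_divide_distrib add_divide_distrib)
    moreover have "has_bochner_integral lborel (indicator {(real_of_int k - a) / s..<(real_of_int k + 1 - a) / s})
        (measure lborel {(real_of_int k - a) / s..<(real_of_int k + 1 - a) / s})"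
      using assms by (intro has_bochner_integral_real_indicator) (auto simp: divide_right_mono)
    ultimately show ?thesis
      by (intro has_bochner_integral_mult_right) auto
  qed
  then have "has_bochner_integral lborel
      (\<lambda>y. \<Sum>k\<in>K. F k * indicator {(real_of_int k - a) / s..<(real_of_int k + 1 - a) / s} y) (\<Sum>k\<in>K. F k * (1 / s))"
    by (rule has_bochner_integral_sum)
  moreover have "(\<Sum>k\<in>K. F k * indicator {(real_of_int k - a) / s..<(real_of_int k + 1 - a) / s} y) = F \<lfloor>a + s * y\<rfloor>" for y
  proof -
    have "indicator {(real_of_int k - a) / s..<(real_of_int k + 1 - a) / s} y = (if k = \<lfloor>a + s * y\<rfloor> then 1 else 0 :: real)" for k
      using assms(3) by (auto simp: indicator_def field_simps eq_commute[of k] floor_eq_iff)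
    then have "(\<Sum>k\<in>K. F k * indicator {(real_of_int k - a) / s..<(real_of_int k + 1 - a) / s} y)
        = (\<Sum>k\<in>K. if k = \<lfloor>a + s * y\<rfloor> then F k else 0)"
      by (intro sum.cong refl) simp
    then show ?thesis
      using assms(1,2) by simp
  qed
  ultimately show ?thesis
    by (simp add: sum_divide_distrib)
qed

lemma integrable_inverse_1_plus_sq: "integrable lborel (\<lambda>x::real. 1 / (1 + x\<^sup>2))"
proof -
  have "integrable lborel (\<lambda>x::real. indicator UNIV x *\<^sub>R inverse (1 + x^2))"
    using integrable_inverse_1_plus_square unfolding set_integrable_def by simp
  then show ?thesis by (simp add: divide_inverse)
qed

text \<open>A lattice sum is the integral of a step function, so dominated convergence turns it into an
  integral in the limit.\<close>

lemma lattice_sum_tendsto: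
  fixes G :: "nat \<Rightarrow> int \<Rightarrow> real"
  assumes fin: "\<And>n. finite (K n)" "\<And>n k. k \<notin> K n \<Longrightarrow> G n k = 0"
    and s: "\<And>n. s n \<ge> 1"
    and bound: "\<And>n k. \<bar>G n k\<bar> \<le> B / (1 + ((real_of_int k - a n) / s n)\<^sup>2)"
    and lim: "\<And>y. (\<lambda>n. G n \<lfloor>a n + s n * y\<rfloor>) \<longlonglongrightarrow> g y"
  shows "(\<lambda>n. (\<Sum>k\<in>K n. G n k) / s n) \<longlonglongrightarrow> (\<integral>y. g y \<partial>lborel)"
proof -
  have int: "has_bochner_integral lborel (\<lambda>y. G n \<lfloor>a n + s n * y\<rfloor>) ((\<Sum>k\<in>K n. G n k) / s n)" for n
    using fin s[of n] by (intro has_bochner_integral_floor) auto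
  have meas: "(\<lambda>y. G n \<lfloor>a n + s n * y\<rfloor>) \<in> borel_measurable lborel" for n
    using int[of n] by (auto simp: has_bochner_integral_iff)
  have "B \<ge> 0"
    using bound[of 0 0] zero_less_divide_iff[of B] 
    by (smt (verit) divide_nonneg_pos divide_less_0_iff zero_le_power2)
  have "(\<lambda>n. \<integral>y. G n \<lfloor>a n + s n * y\<rfloor> \<partial>lborel) \<longlonglongrightarrow> (\<integral>y. g y \<partial>lborel)"
  proof (rule integral_dominated_convergence)
    show "integrable lborel (\<lambda>y. 3 * B * (1 / (1 + y\<^sup>2)))"
      by (intro integrable_mult_right integrable_inverse_1_plus_sq)
    show "AE y in lborel. (\<lambda>n. G n \<lfloor>a n + s n * y\<rfloor>) \<longlonglongrightarrow> g y"
      using lim by simp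
    show "g \<in> borel_measurable lborel"
      by (rule borel_measurable_LIMSEQ_real[OF lim meas])
    show "AE y in lborel. norm (G n \<lfloor>a n + s n * y\<rfloor>) \<le> 3 * B * (1 / (1 + y\<^sup>2))" for n
    proof (rule AE_I2)
      fix y
      \<comment> \<open>Rounding displaces the argument by at most \<open>1 / s n \<le> 1\<close>,
        whence \<open>y^2 \<le> 2 * t^2 + 2\<close>; this is the origin of the factor 3 in the
        majorant.\<close>
      define t where "t = (real_of_int \<lfloor>a n + s n * y\<rfloor> - a n) / s n"
      have "\<bar>t - y\<bar> = \<bar>real_of_int \<lfloor>a n + s n * y\<rfloor> - (a n + s n * y)\<bar> / s n"
        using s[of n] by (simp add: t_def field_simps abs_divide flip: abs_mult)
      also have "\<dots> \<le> 1 / s n"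
        using s[of n] by (intro divide_right_mono) linarith+
      also have "\<dots> \<le> 1" using s[of n] by simp
      finally have "(t - y)\<^sup>2 \<le> 1" by (simp add: abs_square_le_1)
      moreover have "y\<^sup>2 \<le> 2 * t\<^sup>2 + 2 * (t - y)\<^sup>2"
        using zero_le_power2[of "2 * t - y"] by (simp add: power2_eq_square algebra_simps)
      ultimately have "1 + y\<^sup>2 \<le> 3 * (1 + t\<^sup>2)"
        by (smt (verit) zero_le_power2)
      then have "1 / (1 + t\<^sup>2) \<le> 3 * (1 / (1 + y\<^sup>2))"
        by (simp add: field_simps add_pos_nonneg)
      with \<open>B \<ge> 0\<close> have "B * (1 / (1 + t\<^sup>2)) \<le> B * (3 * (1 / (1 + y\<^sup>2)))"
        by (intro mult_left_mono)
      moreover have "\<bar>G n \<lfloor>a n + s n * y\<rfloor>\<bar> \<le> B / (1 + t\<^sup>2)"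
        using bound unfolding t_def .
      ultimately show "norm (G n \<lfloor>a n + s n * y\<rfloor>) \<le> 3 * B * (1 / (1 + y\<^sup>2))"
        by (simp add: mult.commute)
    qed
  qed (rule meas)
  then show ?thesis
    using has_bochner_integral_integral_eq[OF int] by simp
qed

text \<open>Since \<open>t^2 - 1 \<le> t ^ m\<close>, the Gaussian case bounds all the others. Half
  of the Gaussian exponent already dominates a multiple of \<open>1 + t^2\<close>; its square leaves
  one factor to absorb the power of \<open>t\<close> and one to give integrable decay.\<close>

lemma exp_neg_power_bound:
  assumes "c > 0" "even m" "m > 0"
  obtains B where "B > 0" "\<And>(t::real) (j::nat). j \<le> 2 \<Longrightarrow> exp (- c * t ^ m) * \<bar>t\<bar> ^ j \<le> B / (1 + t\<^sup>2)"
proof -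
  \<comment> \<open>The minimum yields \<open>d * (1 + t^2) \<le> 1 + c / 2 * t^2\<close>, to which
    \<open>1 + x \<le> exp x\<close> applies.\<close>
  define d where "d = min 1 (c / 2)"
  have d: "0 < d" "d \<le> 1" "d \<le> c / 2" using assms by (auto simp: d_def)
  have "exp (- c * t ^ m) * \<bar>t\<bar> ^ j \<le> (exp c / d\<^sup>2) / (1 + t\<^sup>2)" if "j \<le> 2" for t :: real and j :: nat
  proof -
    obtain l where l: "m = 2 * l" "l > 0" using assms by (auto elim!: evenE)
    have "t\<^sup>2 - 1 \<le> t ^ m"
    proof (cases "t\<^sup>2 \<le> 1")
      case True
      then show ?thesis using assms(2) by (smt (verit) zero_le_even_power)
    next
      case False
      then have "(t\<^sup>2) ^ 1 \<le> (t\<^sup>2) ^ l" using l by (intro power_increasing) auto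
      then show ?thesis by (simp add: l power_mult)
    qed
    then have "exp (- c * t ^ m) \<le> exp (c - c * t\<^sup>2)"
      using assms by (simp add: algebra_simps) (metis add.commute distrib_left le_diff_eq mult.right_neutral mult_le_cancel_left_pos)
    also have "\<dots> = exp c / (exp (c / 2 * t\<^sup>2))\<^sup>2"
      by (simp add: exp_diff power2_eq_square flip: exp_add)
    finally have e: "exp (- c * t ^ m) \<le> exp c / (exp (c / 2 * t\<^sup>2))\<^sup>2" .
    have "d * (1 + t\<^sup>2) \<le> 1 + c / 2 * t\<^sup>2"
      using d mult_right_mono[OF d(3), of "t\<^sup>2"] by (simp add: ring_distribs)
    also have "\<dots> \<le> exp (c / 2 * t\<^sup>2)" by (rule exp_ge_add_one_self)
    finally have "(d * (1 + t\<^sup>2))\<^sup>2 \<le> (exp (c / 2 * t\<^sup>2))\<^sup>2"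
      using d by (intro power_mono) auto
    then have "exp c / (exp (c / 2 * t\<^sup>2))\<^sup>2 \<le> exp c / (d * (1 + t\<^sup>2))\<^sup>2"
      using d by (intro divide_left_mono mult_pos_pos zero_less_power) (auto simp: add_pos_nonneg)
    with e have e: "exp (- c * t ^ m) \<le> exp c / (d * (1 + t\<^sup>2))\<^sup>2" by linarith
    have "\<bar>t\<bar> ^ j \<le> 1 + t\<^sup>2"
    proof (cases "\<bar>t\<bar> \<le> 1")
      case True
      then have "\<bar>t\<bar> ^ j \<le> 1" by (simp add: power_le_one)
      then show ?thesis by (smt (verit) zero_le_power2)
    next
      case False
      then have "\<bar>t\<bar> ^ j \<le> \<bar>t\<bar> ^ 2" using that by (intro power_increasing) auto
      then show ?thesis by simp
    qed
    with e have "exp (- c * t ^ m) * \<bar>t\<bar> ^ j \<le> exp c / (d * (1 + t\<^sup>2))\<^sup>2 * (1 + t\<^sup>2)"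
      by (intro mult_mono) auto
    also have "\<dots> = (exp c / d\<^sup>2) / (1 + t\<^sup>2)"
    proof -
      have "E / (d * u)\<^sup>2 * u = (E / d\<^sup>2) / u" if "u \<noteq> 0" for E u :: real
        using d that by (simp add: power2_eq_square)
      moreover have "1 + t\<^sup>2 \<noteq> 0" by (smt (verit) zero_le_power2)
      ultimately show ?thesis .
    qed
    finally show ?thesis .
  qed
  with d show ?thesis by (intro that[of "exp c / d\<^sup>2"]) auto
qed

definition power_exp_integral :: "nat \<Rightarrow> real \<Rightarrow> nat \<Rightarrow> real" where
  "power_exp_integral m c j = (\<integral>y. exp (- c * y ^ m) * y ^ j \<partial>lborel)"

text \<open>The fluctuation scale of \<open>k\<close>: \<open>n * (k / n - x0) ^ m\<close> is of
  order one exactly when \<open>k - n * x0\<close> has this size.\<close>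

definition scale :: "nat \<Rightarrow> nat \<Rightarrow> real" where
  "scale m n = real n powr (1 - 1 / real m)"

text \<open>On the window, \<open>k / n - x0 = u * t\<close> with \<open>n * u ^ m = 1\<close>, so
  the exponent is exactly \<open>n * M + R * t ^ m\<close> with \<open>R\<close> tending to
  \<open>- c\<close>, and dominated convergence of lattice sums applies. The claim covers all small
  \<delta>, so that windows around two maximizers can share one \<delta> and be kept
  disjoint.\<close>

lemma local_laplace:
  fixes x0 b1 b2 c :: real and m p :: nat
  defines "M \<equiv> ell p b1 b2 x0"
  assumes x0: "0 < x0" "x0 < 1" and m: "even m" "m > 0" and c: "c > 0"
    and L: "((\<lambda>x. (ell p b1 b2 x - M) / (x - x0) ^ m) \<longlongrightarrow> - c) (at x0)"
  shows "\<forall>\<^sub>F \<delta> in at_right 0. \<forall>j\<le>2.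
      (\<lambda>n. (\<Sum>k | k \<le> n \<and> \<bar>real k / real n - x0\<bar> < \<delta>.
               wt p n b1 b2 k * ((real k - real n * x0) / scale m n) ^ j)
             / (scale m n * exp (real n * M) / sqrt (real n)))
        \<longlonglongrightarrow> power_exp_integral m c j / (stirling_const * sqrt (x0 * (1 - x0)))"
proof -
  have "\<forall>\<^sub>F x in at x0. (ell p b1 b2 x - M) / (x - x0) ^ m < - (c / 2)"
    using L c by (intro order_tendstoD) auto
  then obtain d where d: "d > 0" "\<And>x. x \<noteq> x0 \<Longrightarrow> \<bar>x - x0\<bar> < d \<Longrightarrow> (ell p b1 b2 x - M) / (x - x0) ^ m < - (c / 2)"
    by (auto simp: eventually_at dist_real_def)
  \<comment> \<open>Within this distance the quotient stays below half its limit, which supplies the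
    majorant, and the points keep at least half the distance of \<open>x0\<close> to 0 and to
    1.\<close>
  define \<delta>0 where "\<delta>0 = min d (min (x0 / 2) ((1 - x0) / 2))"
  have \<delta>0: "\<delta>0 > 0" "\<delta>0 \<le> d" "\<delta>0 \<le> x0 / 2" "\<delta>0 \<le> (1 - x0) / 2"
    using d(1) x0 unfolding \<delta>0_def by (auto simp: min_def)
  \<comment> \<open>Filling in the limit at \<open>x0\<close> makes the factorisation of
    \<open>ell - M\<close> valid at every point and \<open>R\<close> continuous at
    \<open>x0\<close>.\<close>
  define R where "R x = (if x = x0 then - c else (ell p b1 b2 x - M) / (x - x0) ^ m)" for x
  have R_eq: "ell p b1 b2 x - M = R x * (x - x0) ^ m" for x
    using m by (auto simp: R_def M_def)
  have R_cont: "isCont R x0"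
    unfolding isCont_def by (rule Lim_transform_eventually[of "\<lambda>x. (ell p b1 b2 x - M) / (x - x0) ^ m"])
       (use L in \<open>auto simp: R_def eventually_at intro!: exI[of _ 1]\<close>)
  have R_le: "R x \<le> - (c / 2)" if "\<bar>x - x0\<bar> < \<delta>0" for x
    using d(2)[of x] that \<delta>0 c by (auto simp: R_def)
  define u where "u n = real n powr (- (1 / real m))" for n
  have s_u: "scale m n = real n * u n" and u_pow: "u n ^ m = 1 / real n" and u_pos: "u n > 0" if "n > 0" for n
  proof -
    have "scale m n = real n powr 1 * real n powr (- (1 / real m))"
      unfolding scale_def by (subst powr_add[symmetric]) simp
    then show "scale m n = real n * u n" using that by (simp add: u_def)
    have "u n ^ m = real n powr (real m * (- (1 / real m)))"
      unfolding u_def by (simp add: powr_power mult.commute that)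
    then show "u n ^ m = 1 / real n" using m that by (simp add: powr_minus_divide)
    show "u n > 0" using that by (simp add: u_def)
  qed
  have s1: "scale m n \<ge> 1" if "n > 0" for n
    using that m unfolding scale_def by (intro ge_one_powr_ge_zero) auto
  have sinf: "filterlim (scale m) at_top sequentially"
  proof -
    have "m \<ge> 2" using m by (auto elim!: evenE)
    then have "1 - 1 / real m > 0" by (simp add: field_simps)
    then show ?thesis unfolding scale_def by real_asymp
  qed
  obtain Br where Br: "Br > 0" "\<And>n. stirling_ratio n \<le> Br" "\<And>n. 1 / stirling_ratio n \<le> Br"
    using stirling_ratio_bounded by metis
  obtain Be where Be: "Be > 0" "\<And>(t::real) (j::nat). j \<le> 2 \<Longrightarrow> exp (- (c / 2) * t ^ m) * \<bar>t\<bar> ^ j \<le> Be / (1 + t\<^sup>2)"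
    using exp_neg_power_bound[of "c / 2" m] c m by auto

  have main: "(\<lambda>n. (\<Sum>k | k \<le> n \<and> \<bar>real k / real n - x0\<bar> < \<delta>.
               wt p n b1 b2 k * ((real k - real n * x0) / scale m n) ^ j)
             / (scale m n * exp (real n * M) / sqrt (real n)))
        \<longlonglongrightarrow> power_exp_integral m c j / (stirling_const * sqrt (x0 * (1 - x0)))"
    if \<delta>: "0 < \<delta>" "\<delta> \<le> \<delta>0" and j: "j \<le> 2" for \<delta> j
  proof -
    define near where "near n k \<longleftrightarrow> n > 0 \<and> 0 \<le> k \<and> k \<le> int n \<and> \<bar>real_of_int k / real n - x0\<bar> < \<delta>" for n :: nat and k :: int
    define t where "t n k = (real_of_int k - real n * x0) / scale m n" for n :: nat and k :: int
    define P where "P n k = stirling_ratio n / (stirling_ratio (nat k) * stirling_ratio (n - nat k))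
         / sqrt (real_of_int k / real n * (1 - real_of_int k / real n))" for n :: nat and k :: int
    \<comment> \<open>The cutoff belongs to the summand because the dominating bound must hold for
      all integers and all \<open>n\<close>.\<close>
    define G where "G n k = (if near n k then wt p n b1 b2 (nat k) * t n k ^ j / (exp (real n * M) / sqrt (real n)) else 0)" for n k
    have x_t: "real_of_int k / real n - x0 = u n * t n k" if "n > 0" for n k
      using that u_pos[OF that] s_u[OF that] by (simp add: t_def field_simps)
    have interior: "0 < k" "k < int n" if "near n k" for n k
    proof -
      have "\<bar>real_of_int k / real n - x0\<bar> < \<delta>" using that by (simp add: near_def)
      then have "real_of_int k / real n > 0" "real_of_int k / real n < 1"
        using \<delta> \<delta>0 x0 by (auto simp: abs_less_iff)
      then show "0 < k" "k < int n" using that by (auto simp: near_def field_simps)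
    qed
    have G_eq: "G n k = P n k * (exp (R (real_of_int k / real n) * t n k ^ m) * t n k ^ j)" if nk: "near n k" for n k
    proof -
      have n: "n > 0" using nk by (simp add: near_def)
      obtain l where l: "k = int l" "0 < l" "l < n"
        using interior[OF nk] by (metis int_nat_eq nat_less_iff of_nat_0_less_iff order_less_imp_le zero_less_nat_eq of_nat_less_iff)
      have "real n * (u n * t n k) ^ m = t n k ^ m"
        using n by (simp add: power_mult_distrib u_pow)
      then have e: "real n * ell p b1 b2 (real l / real n) = real n * M + R (real l / real n) * t n k ^ m"
      proof -
        have "real n * (ell p b1 b2 (real l / real n) - M) = R (real l / real n) * (real n * (u n * t n k) ^ m)"
          using R_eq[of "real l / real n"] x_t[OF n, of k] by (simp add: l)
        then show ?thesis
          unfolding \<open>real n * (u n * t n k) ^ m = t n k ^ m\<close> by (simp add: right_diff_distrib)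
      qed
      have "G n k = stirling_ratio n / (stirling_ratio l * stirling_ratio (n - l))
           / sqrt (real n * (real l / real n) * (1 - real l / real n)) * exp (real n * M + R (real l / real n) * t n k ^ m)
             * t n k ^ j / (exp (real n * M) / sqrt (real n))"
        using nk by (simp add: G_def l(1) wt_eq_stirling[OF l(2,3)] e[unfolded l(1)])
      also have "sqrt (real n * (real l / real n) * (1 - real l / real n)) = sqrt (real n) * sqrt (real l / real n * (1 - real l / real n))"
        by (simp add: mult.assoc flip: real_sqrt_mult)
      finally show ?thesis
        using n by (simp add: P_def l exp_add mult_ac)
    qed
    have P_nonneg: "P n k \<ge> 0" and P_le: "P n k \<le> Br ^ 3 / sqrt (x0 * (1 - x0) / 4)" if nk: "near n k" for n k
    proof -
      define x where "x = real_of_int k / real n"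
      have x: "x0 / 2 \<le> x" "(1 - x0) / 2 \<le> 1 - x"
      proof -
        have "\<bar>x - x0\<bar> < \<delta>" using nk by (simp add: near_def x_def)
        then show "x0 / 2 \<le> x" "(1 - x0) / 2 \<le> 1 - x"
          using \<delta> \<delta>0 by (auto simp: abs_less_iff field_simps)
      qed
      have pos: "stirling_ratio n > 0" "stirling_ratio (nat k) > 0" "stirling_ratio (n - nat k) > 0"
        using interior[OF nk] by (auto intro!: stirling_ratio_pos)
      have "x0 * (1 - x0) / 4 \<le> x * (1 - x)"
        using mult_mono[OF x] x x0 by simp
      then have "sqrt (x0 * (1 - x0) / 4) \<le> sqrt (x * (1 - x))" by simp
      moreover have "stirling_ratio n / (stirling_ratio (nat k) * stirling_ratio (n - nat k)) \<le> Br ^ 3"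
      proof -
        have "stirling_ratio n * ((1 / stirling_ratio (nat k)) * (1 / stirling_ratio (n - nat k))) \<le> Br * (Br * Br)"
          using pos Br by (intro mult_mono mult_nonneg_nonneg) (auto simp: less_imp_le)
        then show ?thesis by (simp add: power3_eq_cube)
      qed
      ultimately show "P n k \<le> Br ^ 3 / sqrt (x0 * (1 - x0) / 4)"
        unfolding P_def x_def[symmetric] using x0 Br(1) x pos by (intro frac_le) auto
      show "P n k \<ge> 0" unfolding P_def x_def[symmetric] using x x0 pos by simp
    qed
    have bound: "\<bar>G n k\<bar> \<le> (Br ^ 3 / sqrt (x0 * (1 - x0) / 4) * Be) / (1 + (t n k)\<^sup>2)" for n k
    proof (cases "near n k")
      case True
      have "R (real_of_int k / real n) * t n k ^ m \<le> - (c / 2) * t n k ^ m"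
        using True \<delta> m by (intro mult_right_mono R_le) (auto simp: near_def)
      then have "exp (R (real_of_int k / real n) * t n k ^ m) * \<bar>t n k\<bar> ^ j \<le> exp (- (c / 2) * t n k ^ m) * \<bar>t n k\<bar> ^ j"
        by (intro mult_right_mono) auto
      also have "\<dots> \<le> Be / (1 + (t n k)\<^sup>2)" using Be(2)[OF j] .
      finally have "P n k * (exp (R (real_of_int k / real n) * t n k ^ m) * \<bar>t n k\<bar> ^ j)
          \<le> Br ^ 3 / sqrt (x0 * (1 - x0) / 4) * (Be / (1 + (t n k)\<^sup>2))"
        using P_nonneg[OF True] P_le[OF True] by (intro mult_mono) auto
      then show ?thesis
        using P_nonneg[OF True] by (simp add: G_eq[OF True] abs_mult power_abs)
    next
      case False
      then show ?thesis using Br Be x0 by (simp add: G_def add_nonneg_nonneg)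
    qed
    have lim: "(\<lambda>n. G n \<lfloor>real n * x0 + scale m n * y\<rfloor>) \<longlonglongrightarrow> exp (- c * y ^ m) * y ^ j / (stirling_const * sqrt (x0 * (1 - x0)))" for y
    proof -
      define k where "k n = \<lfloor>real n * x0 + scale m n * y\<rfloor>" for n
      define x where "x n = real_of_int (k n) / real n" for n
      have t_lim: "(\<lambda>n. t n (k n)) \<longlonglongrightarrow> y"
      proof (rule metric_tendsto_imp_tendsto)
        show "(\<lambda>n. 1 / scale m n) \<longlonglongrightarrow> 0"
          using sinf by (rule real_tendsto_divide_at_top[OF tendsto_const])
        show "\<forall>\<^sub>F n in sequentially. dist (t n (k n)) y \<le> dist (1 / scale m n) 0"
        proof (rule eventually_mono[OF eventually_gt_at_top[of 0]])
          fix n :: nat assume n: "n > 0"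
          have "\<bar>t n (k n) - y\<bar> = \<bar>real_of_int (k n) - (real n * x0 + scale m n * y)\<bar> / scale m n"
            using s1[OF n] by (simp add: t_def field_simps abs_divide flip: abs_mult)
          also have "\<dots> \<le> 1 / scale m n"
            using s1[OF n] unfolding k_def by (intro divide_right_mono) linarith+
          finally show "dist (t n (k n)) y \<le> dist (1 / scale m n) 0"
            using s1[OF n] by (simp add: dist_real_def)
        qed
      qed
      have "u \<longlonglongrightarrow> 0"
        unfolding u_def using m by real_asymp
      from tendsto_add[OF tendsto_const[of x0] tendsto_mult[OF this t_lim]]
      have "(\<lambda>n. x0 + u n * t n (k n)) \<longlonglongrightarrow> x0" by simp
      then have x_lim: "x \<longlonglongrightarrow> x0"
        by (rule Lim_transform_eventually)
           (auto intro!: eventually_mono[OF eventually_gt_at_top[of 0]] simp: x_def x_t[symmetric])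
      have "\<forall>\<^sub>F n in sequentially. \<bar>x n - x0\<bar> < \<delta>"
        using tendstoD[OF x_lim \<delta>(1)] by (simp add: dist_real_def)
      moreover have "\<forall>\<^sub>F n in sequentially. x n > 0" "\<forall>\<^sub>F n in sequentially. x n < 1"
        using order_tendstoD[OF x_lim] x0 by auto
      ultimately have near: "\<forall>\<^sub>F n in sequentially. near n (k n)"
        using eventually_gt_at_top[of 0]
        by eventually_elim (auto simp: near_def x_def field_simps)
      have k_inf: "filterlim (\<lambda>n. nat (k n)) at_top sequentially"
      proof -
        have "filterlim (\<lambda>n. x n * real n) at_top sequentially"
          by (rule filterlim_tendsto_pos_mult_at_top[OF x_lim x0(1) filterlim_real_sequentially])
        then have "filterlim (\<lambda>n. real (nat (k n))) at_top sequentially"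
          by (rule filterlim_mono_eventually[OF _ order_refl order_refl])
             (use near in \<open>auto elim!: eventually_mono simp: near_def x_def\<close>)
        then show ?thesis by (simp add: filterlim_sequentially_iff_filterlim_real)
      qed
      have nk_inf: "filterlim (\<lambda>n. n - nat (k n)) at_top sequentially"
      proof -
        have "filterlim (\<lambda>n. (1 - x n) * real n) at_top sequentially"
          by (rule filterlim_tendsto_pos_mult_at_top[OF tendsto_diff[OF tendsto_const x_lim] _ filterlim_real_sequentially])
             (use x0 in auto)
        then have "filterlim (\<lambda>n. real (n - nat (k n))) at_top sequentially"
          by (rule filterlim_mono_eventually[OF _ order_refl order_refl])
             (use near in \<open>auto elim!: eventually_mono simp: near_def x_def field_simps of_nat_diff nat_le_iff\<close>)
        then show ?thesis by (simp add: filterlim_sequentially_iff_filterlim_real)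
      qed
      note S = filterlim_compose[OF stirling_const(2)]
      \<comment> \<open>All three indices tend to infinity, so each Stirling ratio tends to
        \<open>stirling_const\<close>; one such factor survives in the denominator.\<close>
      have "(\<lambda>n. P n (k n)) \<longlonglongrightarrow> stirling_const / (stirling_const * stirling_const) / sqrt (x0 * (1 - x0))"
        unfolding P_def x_def[symmetric] using x0 stirling_const(1)
        by (intro tendsto_intros S[OF k_inf] S[OF nk_inf] stirling_const(2) x_lim) auto
      moreover have "(\<lambda>n. R (x n)) \<longlonglongrightarrow> R x0"
        by (rule isCont_tendsto_compose[OF R_cont x_lim])
      ultimately have "(\<lambda>n. P n (k n) * (exp (R (x n) * t n (k n) ^ m) * t n (k n) ^ j))
        \<longlonglongrightarrow> stirling_const / (stirling_const * stirling_const) / sqrt (x0 * (1 - x0)) * (exp (R x0 * y ^ m) * y ^ j)"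
        by (intro tendsto_intros t_lim)
      also have "stirling_const / (stirling_const * stirling_const) / sqrt (x0 * (1 - x0)) * (exp (R x0 * y ^ m) * y ^ j)
          = exp (- c * y ^ m) * y ^ j / (stirling_const * sqrt (x0 * (1 - x0)))"
        using stirling_const(1) by (simp add: R_def)
      finally show ?thesis
        unfolding k_def[symmetric] 
        by (rule Lim_transform_eventually) (use near in \<open>auto elim!: eventually_mono simp: G_eq x_def\<close>)
    qed
    \<comment> \<open>\<open>scale m 0 = 0\<close>, while \<open>lattice_sum_tendsto\<close> asks
      for a scale of at least 1 at every index; the maximum differs from the scale only at
      \<open>n = 0\<close>.\<close>
    have "(\<lambda>n. (\<Sum>k\<in>{0..int n}. G n k) / max 1 (scale m n))
        \<longlonglongrightarrow> (\<integral>y. exp (- c * y ^ m) * y ^ j / (stirling_const * sqrt (x0 * (1 - x0))) \<partial>lborel)"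
    proof (rule lattice_sum_tendsto[where a = "\<lambda>n. real n * x0" and B = "Br ^ 3 / sqrt (x0 * (1 - x0) / 4) * Be"])
      show "\<bar>G n k\<bar> \<le> Br ^ 3 / sqrt (x0 * (1 - x0) / 4) * Be / (1 + ((real_of_int k - real n * x0) / max 1 (scale m n))\<^sup>2)" for n k
      proof (cases "n = 0")
        case True
        then show ?thesis using Br Be x0 by (simp add: G_def near_def add_nonneg_nonneg)
      next
        case False
        then show ?thesis using bound[of n k] s1[of n] by (simp add: t_def max_def)
      qed
      show "(\<lambda>n. G n \<lfloor>real n * x0 + max 1 (scale m n) * y\<rfloor>) \<longlonglongrightarrow> exp (- c * y ^ m) * y ^ j / (stirling_const * sqrt (x0 * (1 - x0)))" for y
        by (rule Lim_transform_eventually[OF lim])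
           (auto intro!: eventually_mono[OF eventually_gt_at_top[of 0]] simp: max_absorb2 s1)
    qed (auto simp: G_def near_def)
    also have "(\<integral>y. exp (- c * y ^ m) * y ^ j / (stirling_const * sqrt (x0 * (1 - x0))) \<partial>lborel)
        = power_exp_integral m c j / (stirling_const * sqrt (x0 * (1 - x0)))"
      by (simp add: power_exp_integral_def)
    finally show ?thesis
    proof (rule Lim_transform_eventually)
      show "\<forall>\<^sub>F n in sequentially. (\<Sum>k\<in>{0..int n}. G n k) / max 1 (scale m n) =
         (\<Sum>k | k \<le> n \<and> \<bar>real k / real n - x0\<bar> < \<delta>. wt p n b1 b2 k * ((real k - real n * x0) / scale m n) ^ j)
             / (scale m n * exp (real n * M) / sqrt (real n))"
      proof (rule eventually_mono[OF eventually_gt_at_top[of 0]])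
        fix n :: nat assume n: "n > 0"
        have "(\<Sum>k\<in>{0..int n}. G n k) = (\<Sum>k\<le>n. G n (int k))"
          by (rule sum.reindex_bij_witness[where i = int and j = nat]) auto
        also have "\<dots> = (\<Sum>k | k \<le> n \<and> \<bar>real k / real n - x0\<bar> < \<delta>. G n (int k))"
          by (rule sum.mono_neutral_right) (auto simp: G_def near_def)
        also have "\<dots> = (\<Sum>k | k \<le> n \<and> \<bar>real k / real n - x0\<bar> < \<delta>.
               wt p n b1 b2 k * ((real k - real n * x0) / scale m n) ^ j / (exp (real n * M) / sqrt (real n)))"
          using n by (intro sum.cong) (auto simp: G_def near_def t_def)
        also have "\<dots> = (\<Sum>k | k \<le> n \<and> \<bar>real k / real n - x0\<bar> < \<delta>.
               wt p n b1 b2 k * ((real k - real n * x0) / scale m n) ^ j) / (exp (real n * M) / sqrt (real n))"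
          by (simp only: sum_divide_distrib)
        finally show "(\<Sum>k\<in>{0..int n}. G n k) / max 1 (scale m n) =
         (\<Sum>k | k \<le> n \<and> \<bar>real k / real n - x0\<bar> < \<delta>. wt p n b1 b2 k * ((real k - real n * x0) / scale m n) ^ j)
             / (scale m n * exp (real n * M) / sqrt (real n))"
          using s1[OF n] by (simp only: max_absorb2 divide_divide_eq_left divide_divide_eq_right times_divide_eq_right mult_ac)
      qed
    qed
  qed
  show ?thesis
    unfolding eventually_at_right_field using main \<delta>0(1) by (intro exI[of _ \<delta>0]) auto
qed

section \<open>Maximizers of the free energy\<close>

definition ell_d1 :: "nat \<Rightarrow> real \<Rightarrow> real \<Rightarrow> real \<Rightarrow> real" where
  "ell_d1 p b1 b2 x = b1 + b2 * real p * x ^ (p - 1) - ln x + ln (1 - x)"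

definition ell_d2 :: "nat \<Rightarrow> real \<Rightarrow> real \<Rightarrow> real" where
  "ell_d2 p b2 x = b2 * real p * (real p - 1) * x ^ (p - 2) - 1 / (x * (1 - x))"

context
  fixes p :: nat
  assumes p: "p \<ge> 2"
begin

definition xc :: real where "xc = (real p - 1) / real p"

lemma xc: "0 < xc" "xc < 1"
  using p by (auto simp: xc_def)

lemma one_minus_xc: "1 - xc = 1 / real p"
  using p by (simp add: xc_def field_simps)

lemma ell_deriv:
  assumes "0 < x" "x < 1"
  shows "(ell p b1 b2 has_real_derivative ell_d1 p b1 b2 x) (at x)"
proof -
  have "(ell p b1 b2 has_real_derivative b1 + b2 * (real p * x ^ (p - 1)) - (ln x + x * (1 / x))
          - (- ln (1 - x) + (1 - x) * (- 1 / (1 - x)))) (at x)"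
    unfolding ell_def[abs_def] using assms by (auto intro!: derivative_eq_intros)
  then show ?thesis using assms by (simp add: ell_d1_def algebra_simps)
qed

lemma ell_d1_deriv:
  assumes "0 < x" "x < 1"
  shows "(ell_d1 p b1 b2 has_real_derivative ell_d2 p b2 x) (at x)"
proof -
  have "(ell_d1 p b1 b2 has_real_derivative b2 * real p * (real (p - 1) * x ^ (p - 1 - 1)) - 1 / x - 1 / (1 - x)) (at x)"
    unfolding ell_d1_def[abs_def] using assms
    by (auto intro!: derivative_eq_intros simp: field_simps)
  also have "b2 * real p * (real (p - 1) * x ^ (p - 1 - 1)) - 1 / x - 1 / (1 - x) = ell_d2 p b2 x"
    using assms p by (simp add: ell_d2_def of_nat_diff diff_diff_eq numeral_2_eq_2 field_simps)
  finally show ?thesis .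
qed

lemma ell''_eq:
  assumes "0 < x" "x < 1"
  shows "ell'' p b1 b2 x = ell_d2 p b2 x"
proof -
  have "\<forall>\<^sub>F y in nhds x. y \<in> {0<..<1}"
    using assms by (intro eventually_nhds_in_open) auto
  then have "\<forall>\<^sub>F y in nhds x. deriv (ell p b1 b2) y = ell_d1 p b1 b2 y"
    by eventually_elim (auto intro!: DERIV_imp_deriv ell_deriv)
  then have "deriv (deriv (ell p b1 b2)) x = deriv (ell_d1 p b1 b2) x"
    by (intro deriv_cong_ev refl)
  also have "\<dots> = ell_d2 p b2 x"
    by (intro DERIV_imp_deriv ell_d1_deriv assms)
  finally show ?thesis by (simp add: ell''_def)
qed

text \<open>Only \<open>x * ln x\<close> at 0 is delicate: its right limit is 0, which is also its
  value by \<open>0 * ln 0 = 0\<close>. The other entropy term is a reflection of this one.\<close>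

lemma continuous_on_ell: "continuous_on {0..1} (\<lambda>x. ell p b1 b2 x)"
proof -
  have xlnx: "continuous_on {0..} (\<lambda>x::real. x * ln x)"
    unfolding continuous_on_def
  proof
    fix x :: real assume "x \<in> {0..}"
    show "((\<lambda>x. x * ln x) \<longlongrightarrow> x * ln x) (at x within {0..})"
    proof (cases "x = 0")
      case True
      have "((\<lambda>x::real. x * ln x) \<longlongrightarrow> 0) (at_right 0)" by real_asymp
      then show ?thesis using True by (simp add: at_within_Ici_at_right)
    next
      case False
      then show ?thesis using \<open>x \<in> {0..}\<close> by (auto intro!: tendsto_intros)
    qed
  qed
  have "continuous_on {0..1} (\<lambda>x::real. (1 - x) * ln (1 - x))"
    by (rule continuous_on_compose2[OF xlnx]) (auto intro!: continuous_intros)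
  moreover have "continuous_on {0..1} (\<lambda>x::real. x * ln x)"
    by (rule continuous_on_subset[OF xlnx]) auto
  ultimately show ?thesis
    unfolding ell_def by (intro continuous_on_diff continuous_on_add continuous_on_mult_left continuous_on_power continuous_on_id)
qed

lemma mem_maximizers: "x \<in> maximizers p b1 b2 \<longleftrightarrow> x \<in> {0..1} \<and> (\<forall>y\<in>{0..1}. ell p b1 b2 y \<le> ell p b1 b2 x)"
  by (auto simp: maximizers_def is_arg_max_def not_less)

lemma maximizers_nonempty: "maximizers p b1 b2 \<noteq> {}"
proof -
  obtain x where "x \<in> {0..1}" "\<forall>y\<in>{0..1}. ell p b1 b2 y \<le> ell p b1 b2 x"
    using continuous_attains_sup[of "{0..1::real}" "ell p b1 b2"] continuous_on_ell by auto
  then have "x \<in> maximizers p b1 b2" by (simp add: mem_maximizers)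
  then show ?thesis by blast
qed

text \<open>The logarithms drive \<open>ell_d1\<close> to plus infinity at 0 and to minus infinity
  at 1, so moving inward from either endpoint increases \<open>ell\<close>.\<close>

lemma maximizer_interior:
  assumes "x \<in> maximizers p b1 b2"
  shows "0 < x" "x < 1"
proof -
  have x: "0 \<le> x" "x \<le> 1" "\<And>y. 0 \<le> y \<Longrightarrow> y \<le> 1 \<Longrightarrow> ell p b1 b2 y \<le> ell p b1 b2 x"
    using assms by (auto simp: mem_maximizers)
  have incr: "ell p b1 b2 u < ell p b1 b2 v"
    if "0 \<le> u" "u < v" "v \<le> 1" "\<And>y. u < y \<Longrightarrow> y < v \<Longrightarrow> ell_d1 p b1 b2 y > 0" for u v
    using that by (intro DERIV_pos_imp_increasing_open[OF that(2)])
      (auto intro!: exI[of _ "ell_d1 p b1 b2 _"] ell_deriv continuous_on_subset[OF continuous_on_ell])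
  have decr: "ell p b1 b2 u > ell p b1 b2 v"
    if "0 \<le> u" "u < v" "v \<le> 1" "\<And>y. u < y \<Longrightarrow> y < v \<Longrightarrow> ell_d1 p b1 b2 y < 0" for u v
    using that by (intro DERIV_neg_imp_decreasing_open[OF that(2)])
      (auto intro!: exI[of _ "ell_d1 p b1 b2 _"] ell_deriv continuous_on_subset[OF continuous_on_ell])
  have "x \<noteq> 0"
  proof
    assume "x = 0"
    have "filterlim (\<lambda>x. b1 + b2 * real p * x ^ (p - 1) + ln (1 - x) + - ln x) at_top (at_right 0)"
      by (rule filterlim_tendsto_add_at_top[where c = "b1 + b2 * real p * 0 ^ (p - 1) + ln (1 - 0)"])
         (auto intro!: tendsto_eq_intros filterlim_uminus_at_top_at_bot[THEN filterlim_compose] ln_at_0)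
    then have "\<forall>\<^sub>F x in at_right 0. ell_d1 p b1 b2 x > 0"
      by (auto simp: filterlim_at_top_dense ell_d1_def algebra_simps elim!: allE[of _ 0])
    then obtain d where d: "d > 0" "\<And>y. 0 < y \<Longrightarrow> y < d \<Longrightarrow> ell_d1 p b1 b2 y > 0"
      by (auto simp: eventually_at_right_field)
    have "ell p b1 b2 0 < ell p b1 b2 (min d 1)"
      using d by (intro incr) auto
    then show False using x(3)[of "min d 1"] d \<open>x = 0\<close> by auto
  qed
  moreover have "x \<noteq> 1"
  proof
    assume "x = 1"
    have "filterlim (\<lambda>x. 1 - x) (at_right 0) (at_left (1::real))"
      by (auto simp: filterlim_at eventually_at_left_field intro!: tendsto_eq_intros exI[of _ 0])
    then have "filterlim (\<lambda>x::real. ln (1 - x)) at_bot (at_left 1)"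
      by (rule filterlim_compose[OF ln_at_0])
    then have "filterlim (\<lambda>x::real. - ln (1 - x)) at_top (at_left 1)"
      by (simp add: filterlim_uminus_at_top)
    then have "filterlim (\<lambda>x. - b1 - b2 * real p * x ^ (p - 1) + ln x + - ln (1 - x)) at_top (at_left 1)"
      by (intro filterlim_tendsto_add_at_top[where c = "- b1 - b2 * real p * 1 ^ (p - 1) + ln 1"])
         (auto intro!: tendsto_eq_intros)
    then have "\<forall>\<^sub>F x in at_left 1. ell_d1 p b1 b2 x < 0"
      by (auto simp: filterlim_at_top_dense ell_d1_def algebra_simps elim!: allE[of _ 0])
    then obtain d where d: "d < 1" "\<And>y. d < y \<Longrightarrow> y < 1 \<Longrightarrow> ell_d1 p b1 b2 y < 0"
      by (auto simp: eventually_at_left_field)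
    have "ell p b1 b2 (max d 0) > ell p b1 b2 1"
      using d by (intro decr) auto
    then show False using x(3)[of "max d 0"] d \<open>x = 1\<close> by auto
  qed
  ultimately show "0 < x" "x < 1" using x by auto
qed

lemma maximizer_d1:
  assumes "x \<in> maximizers p b1 b2"
  shows "ell_d1 p b1 b2 x = 0"
proof (rule DERIV_local_max)
  note x = maximizer_interior[OF assms]
  show "(ell p b1 b2 has_real_derivative ell_d1 p b1 b2 x) (at x)" using x by (rule ell_deriv)
  show "min x (1 - x) > 0" using x by simp
  show "\<forall>y. \<bar>x - y\<bar> < min x (1 - x) \<longrightarrow> ell p b1 b2 y \<le> ell p b1 b2 x"
    using assms by (auto simp: mem_maximizers abs_less_iff intro!: bspec)
qed

lemma d1_mono_imp_not_maximizer:
  assumes "x < v" "v \<le> 1" "\<And>y. x < y \<Longrightarrow> y < v \<Longrightarrow> ell_d1 p b1 b2 y > 0"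
  shows "x \<notin> maximizers p b1 b2"
proof
  assume x: "x \<in> maximizers p b1 b2"
  note xi = maximizer_interior[OF x]
  have "ell p b1 b2 x < ell p b1 b2 v"
    using assms xi by (intro DERIV_pos_imp_increasing_open[OF assms(1)])
      (auto intro!: exI[of _ "ell_d1 p b1 b2 _"] ell_deriv continuous_on_subset[OF continuous_on_ell])
  then show False using x assms xi by (auto simp: mem_maximizers dest!: bspec[of _ _ v])
qed

lemma d1_antimono_imp_not_maximizer:
  assumes "v < x" "0 \<le> v" "\<And>y. v < y \<Longrightarrow> y < x \<Longrightarrow> ell_d1 p b1 b2 y < 0"
  shows "x \<notin> maximizers p b1 b2"
proof
  assume x: "x \<in> maximizers p b1 b2"
  note xi = maximizer_interior[OF x]
  have "ell p b1 b2 v > ell p b1 b2 x"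
    using assms xi by (intro DERIV_neg_imp_decreasing_open[OF assms(1)])
      (auto intro!: exI[of _ "ell_d1 p b1 b2 _"] ell_deriv continuous_on_subset[OF continuous_on_ell])
  then show False using x assms xi by (auto simp: mem_maximizers dest!: bspec[of _ _ v])
qed

lemma d1_strict_mono:
  assumes "0 < u" "u < v" "v < 1" "\<And>y. u < y \<Longrightarrow> y < v \<Longrightarrow> ell_d2 p b2 y > 0"
  shows "ell_d1 p b1 b2 u < ell_d1 p b1 b2 v"
  using assms by (intro DERIV_pos_imp_increasing_open[OF assms(2)])
    (auto intro!: exI[of _ "ell_d2 p b2 _"] ell_d1_deriv DERIV_continuous_on[OF DERIV_subset[OF ell_d1_deriv]])

lemma d1_strict_antimono:
  assumes "0 < u" "u < v" "v < 1" "\<And>y. u < y \<Longrightarrow> y < v \<Longrightarrow> ell_d2 p b2 y < 0"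
  shows "ell_d1 p b1 b2 v < ell_d1 p b1 b2 u"
  using assms by (intro DERIV_neg_imp_decreasing_open[OF assms(2)])
    (auto intro!: exI[of _ "ell_d2 p b2 _"] ell_d1_deriv DERIV_continuous_on[OF DERIV_subset[OF ell_d1_deriv]])

lemma maximizer_d2:
  assumes x: "x \<in> maximizers p b1 b2"
  shows "ell_d2 p b2 x \<le> 0"
proof (rule ccontr)
  assume "\<not> ell_d2 p b2 x \<le> 0"
  note xi = maximizer_interior[OF x]
  from DERIV_pos_inc_right[OF ell_d1_deriv[OF xi]] \<open>\<not> ell_d2 p b2 x \<le> 0\<close>
  obtain d where d: "d > 0" "\<And>h. 0 < h \<Longrightarrow> h < d \<Longrightarrow> ell_d1 p b1 b2 (x + h) > ell_d1 p b1 b2 x"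
    by (metis not_le)
  have "x \<notin> maximizers p b1 b2"
    by (rule d1_mono_imp_not_maximizer[of x "min 1 (x + d)"])
       (use d(1) d(2)[of "_ - x"] xi maximizer_d1[OF x] in auto)
  with x show False by simp
qed

section \<open>Convexity of \<open>ell\<close> and the critical parameters\<close>

definition hump :: "real \<Rightarrow> real" where "hump x = x ^ (p - 1) * (1 - x)"

text \<open>The sign of the second derivative is decided by comparing \<open>hump\<close> with a
  constant. As \<open>hump\<close> has a single peak, at \<open>xc\<close>, the region where
  \<open>ell\<close> is convex is empty or an interval around \<open>xc\<close>.\<close>

lemma ell_d2_hump:
  assumes "0 < x" "x < 1"
  shows "ell_d2 p b2 x = (b2 * real p * (real p - 1) * hump x - 1) / (x * (1 - x))"
proof -
  have "x ^ (p - 1) = x * x ^ (p - 2)"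
    using p by (metis Suc_diff_le diff_Suc_Suc numeral_2_eq_2 power_Suc One_nat_def)
  then show ?thesis using assms by (simp add: ell_d2_def hump_def field_simps)
qed

lemma hump_deriv:
  "(hump has_real_derivative real p * x ^ (p - 2) * (xc - x)) (at x)"
proof -
  have "x ^ (p - 1) = x * x ^ (p - 2)"
    using p by (metis Suc_diff_le diff_Suc_Suc numeral_2_eq_2 power_Suc One_nat_def)
  then have "real (p - 1) * x ^ (p - 1 - 1) * (1 - x) - x ^ (p - 1) = real p * x ^ (p - 2) * (xc - x)"
    using p by (simp add: xc_def of_nat_diff numeral_2_eq_2 field_simps)
  moreover have "(hump has_real_derivative real (p - 1) * x ^ (p - 1 - 1) * (1 - x) - x ^ (p - 1)) (at x)"
    unfolding hump_def[abs_def] by (auto intro!: derivative_eq_intros)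
  ultimately show ?thesis by metis
qed

lemma hump_increasing:
  assumes "0 \<le> u" "u < v" "v \<le> xc"
  shows "hump u < hump v"
proof (rule DERIV_pos_imp_increasing_open[OF assms(2)])
  fix x assume "u < x" "x < v"
  then show "\<exists>y. (hump has_real_derivative y) (at x) \<and> y > 0"
    using assms p by (intro exI[of _ "real p * x ^ (p - 2) * (xc - x)"] conjI hump_deriv mult_pos_pos zero_less_power) auto
qed (auto simp: hump_def[abs_def] intro!: continuous_intros)

lemma hump_decreasing:
  assumes "xc \<le> u" "u < v"
  shows "hump v < hump u"
proof (rule DERIV_neg_imp_decreasing_open[OF assms(2)])
  fix x assume "u < x" "x < v"
  then show "\<exists>y. (hump has_real_derivative y) (at x) \<and> y < 0"
    using assms p xc less_trans[OF xc(1), of x]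
    by (intro exI[of _ "real p * x ^ (p - 2) * (xc - x)"] conjI hump_deriv mult_pos_neg mult_pos_pos zero_less_power) auto
qed (auto simp: hump_def[abs_def] intro!: continuous_intros)

lemma \<beta>2c_alt: "\<beta>2c p = real p ^ (p - 1) / ((real p - 1) * (real p - 1) ^ (p - 1))"
proof -
  have "(real p - 1) ^ p = (real p - 1) * (real p - 1) ^ (p - 1)"
    using p by (metis Suc_diff_1 less_le_trans pos2 power_Suc)
  then show ?thesis by (simp only: \<beta>2c_def)
qed

text \<open>Origin of \<beta>2c: it is the value at which the peak of \<open>hump\<close> just
  reaches the threshold, so that \<open>ell\<close> is about to acquire a convex region.\<close>

lemma \<beta>2c_hump: "\<beta>2c p > 0" "\<beta>2c p * real p * (real p - 1) * hump xc = 1"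
proof -
  show "\<beta>2c p > 0" using p by (simp add: \<beta>2c_def)
  have "A / (u * B) * v * u * (B / A * (1 / v)) = 1" if "A > 0" "B > 0" "u > 0" "v > 0" for A B u v :: real
    using that by simp
  then show "\<beta>2c p * real p * (real p - 1) * hump xc = 1"
    using p unfolding \<beta>2c_alt hump_def one_minus_xc unfolding xc_def power_divide by simp
qed

text \<open>Origin of \<beta>1c: given \<beta>2c, it is the value that makes \<open>xc\<close> a
  critical point of \<open>ell\<close>.\<close>

lemma \<beta>1c_eq: "\<beta>1c p + \<beta>2c p * real p * xc ^ (p - 1) - ln xc + ln (1 - xc) = 0"
proof -
  have "ln xc = ln (real p - 1) - ln (real p)" "ln (1 - xc) = - ln (real p)"
    using p unfolding one_minus_xc by (simp_all add: xc_def ln_div)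
  moreover have "\<beta>2c p * real p * xc ^ (p - 1) = real p / (real p - 1)"
  proof -
    have "A / (u * B) * v * (B / A) = v / u" if "A > 0" "B > 0" for A B u v :: real
      using that by simp
    then show ?thesis
      using p unfolding \<beta>2c_alt unfolding xc_def power_divide by simp
  qed
  ultimately show ?thesis by (simp add: \<beta>1c_def)
qed

lemma ell_d1_xc: "ell_d1 p b1 b2 xc = (b1 - \<beta>1c p) + (b2 - \<beta>2c p) * real p * xc ^ (p - 1)"
  using \<beta>1c_eq by (simp add: ell_d1_def algebra_simps)

lemma ell_d2_neg_iff:
  assumes "0 < x" "x < 1"
  shows "ell_d2 p b2 x < 0 \<longleftrightarrow> b2 * real p * (real p - 1) * hump x < 1"
    "ell_d2 p b2 x \<le> 0 \<longleftrightarrow> b2 * real p * (real p - 1) * hump x \<le> 1"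
    "ell_d2 p b2 x > 0 \<longleftrightarrow> b2 * real p * (real p - 1) * hump x > 1"
proof -
  have "x * (1 - x) > 0" using assms by simp
  then show "ell_d2 p b2 x < 0 \<longleftrightarrow> b2 * real p * (real p - 1) * hump x < 1"
    "ell_d2 p b2 x \<le> 0 \<longleftrightarrow> b2 * real p * (real p - 1) * hump x \<le> 1"
    "ell_d2 p b2 x > 0 \<longleftrightarrow> b2 * real p * (real p - 1) * hump x > 1"
    unfolding ell_d2_hump[OF assms] by (simp_all only: pos_divide_less_eq pos_divide_le_eq pos_less_divide_eq) auto
qed

text \<open>Both halves of the unit interval contain at most one maximizer: if the second derivative
  is nonpositive at some point, then it is negative on the part of that half away from \<open>xc\<close>.\<close>

lemma ell_d2_neg_outward:
  assumes "ell_d2 p b2 y \<le> 0" "0 < y" "y < 1" "0 < x" "x < 1" "x < y \<and> y \<le> xc \<or> xc \<le> y \<and> y < x"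
  shows "ell_d2 p b2 x < 0"
proof -
  have h: "0 < hump x" "hump x < hump y"
    using assms hump_increasing[of x y] hump_decreasing[of y x] by (auto simp: hump_def)
  show ?thesis
  proof (cases "b2 > 0")
    case True
    then have "b2 * real p * (real p - 1) * hump x < b2 * real p * (real p - 1) * hump y"
      using h p by (intro mult_strict_left_mono) auto
    then show ?thesis using assms by (simp add: ell_d2_neg_iff)
  next
    case False
    then have "b2 * real p * (real p - 1) * hump x \<le> 0"
      using h p by (intro mult_nonpos_nonneg) (auto intro!: mult_nonpos_nonneg)
    then show ?thesis using assms by (simp add: ell_d2_neg_iff)
  qed
qed

text \<open>Of two maximizers in one half, the one nearer to \<open>xc\<close> has nonpositive
  second derivative, so \<open>ell_d1\<close> decreases strictly between them and cannot vanish at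
  both.\<close>

lemma maximizer_unique_half:
  assumes x: "x \<in> maximizers p b1 b2" and y: "y \<in> maximizers p b1 b2"
    and "x \<le> xc \<and> y \<le> xc \<or> xc \<le> x \<and> xc \<le> y"
  shows "x = y"
proof -
  have *: False if x: "x \<in> maximizers p b1 b2" and y: "y \<in> maximizers p b1 b2" and xy: "x < y" "y \<le> xc \<or> xc \<le> x" for x y
  proof -
    note xi = maximizer_interior[OF x] and yi = maximizer_interior[OF y]
    have "ell_d2 p b2 z < 0" if "x < z" "z < y" for z
      using xy(2)
    proof
      assume "y \<le> xc"
      with that xi yi show ?thesis by (intro ell_d2_neg_outward[OF maximizer_d2[OF y]]) simp_all
    next
      assume "xc \<le> x"
      with that xi yi show ?thesis by (intro ell_d2_neg_outward[OF maximizer_d2[OF x]]) simp_all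
    qed
    then have "ell_d1 p b1 b2 y < ell_d1 p b1 b2 x"
      using xy(1) xi yi by (intro d1_strict_antimono)
    then show False using maximizer_d1[OF x] maximizer_d1[OF y] by simp
  qed
  show ?thesis
    using *[OF x y] *[OF y x] assms(3) by (meson linorder_neqE)
qed

text \<open>The second-order condition at the peak of \<open>hump\<close> bounds \<beta>2, and the
  first-order condition then places the parameters on a line through the critical point. This serves
  to exclude \<open>xc\<close> as a maximizer.\<close>

lemma maximizer_xc:
  assumes "xc \<in> maximizers p b1 b2"
  shows "b2 \<le> \<beta>2c p" "b1 - \<beta>1c p = (\<beta>2c p - b2) * real p * xc ^ (p - 1)"
proof -
  have "hump xc > 0" using xc by (simp add: hump_def)
  then have "real p * (real p - 1) * hump xc > 0" using p by simp
  moreover have "b2 * (real p * (real p - 1) * hump xc) \<le> \<beta>2c p * (real p * (real p - 1) * hump xc)"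
    using maximizer_d2[OF assms] ell_d2_neg_iff(2)[OF xc, of b2] \<beta>2c_hump(2) by (simp only: mult.assoc)
  ultimately show "b2 \<le> \<beta>2c p" by (rule mult_right_le_imp_le[rotated])
  show "b1 - \<beta>1c p = (\<beta>2c p - b2) * real p * xc ^ (p - 1)"
    using maximizer_d1[OF assms] unfolding ell_d1_xc by (simp add: algebra_simps)
qed

lemma ell_d2_neg:
  assumes "b2 < \<beta>2c p \<or> b2 = \<beta>2c p \<and> x \<noteq> xc" "0 < x" "x < 1"
  shows "ell_d2 p b2 x < 0"
proof -
  have "hump x > 0" using assms by (simp add: hump_def)
  moreover have "x \<noteq> xc \<Longrightarrow> hump xc > hump x"
    using assms hump_increasing[of x xc] hump_decreasing[of xc x] by (cases x xc rule: linorder_cases) auto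
  ultimately have h: "hump x > 0" "hump xc \<ge> hump x" "x \<noteq> xc \<Longrightarrow> hump xc > hump x"
    by (cases "x = xc"; simp)+
  have pp: "real p * (real p - 1) > 0" using p by simp
  have "b2 * (real p * (real p - 1) * hump x) < \<beta>2c p * (real p * (real p - 1) * hump xc)"
  proof (cases "b2 < \<beta>2c p")
    case True
    then have "b2 * (real p * (real p - 1) * hump x) < \<beta>2c p * (real p * (real p - 1) * hump x)"
      using h pp by (intro mult_strict_right_mono) auto
    also have "\<dots> \<le> \<beta>2c p * (real p * (real p - 1) * hump xc)"
      using h pp \<beta>2c_hump(1) by (intro mult_left_mono) auto
    finally show ?thesis .
  next
    case False
    then show ?thesis
      using assms(1) h(3) pp \<beta>2c_hump(1) by (simp only: mult_strict_left_mono simp_thms)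
  qed
  then show ?thesis
    using assms \<beta>2c_hump(2) by (simp add: ell_d2_neg_iff mult.assoc)
qed

text \<open>For \<beta>2 above its critical value, a maximizer with vanishing second derivative
  would have larger values of \<open>hump\<close> between itself and \<open>xc\<close>. There
  \<open>ell\<close> is convex and \<open>ell_d1\<close> starts from 0, so \<open>ell\<close>
  increases towards \<open>xc\<close>, a contradiction.\<close>

lemma maximizer_nondegenerate:
  assumes x: "x \<in> maximizers p b1 b2" and "(b1, b2) \<noteq> (\<beta>1c p, \<beta>2c p)"
  shows "ell_d2 p b2 x < 0"
proof -
  note xi = maximizer_interior[OF x]
  show ?thesis
  proof (cases "b2 < \<beta>2c p \<or> b2 = \<beta>2c p \<and> x \<noteq> xc")
    case True
    then show ?thesis using ell_d2_neg xi by blast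
  next
    case False
    have "x \<noteq> xc"
      using False maximizer_xc[of b1 b2] x assms(2) by auto
    then have b2: "b2 > \<beta>2c p" using False by auto
    show ?thesis
    proof (rule ccontr)
      assume "\<not> ell_d2 p b2 x < 0"
      then have e: "b2 * real p * (real p - 1) * hump x \<ge> 1"
        using xi by (simp add: ell_d2_neg_iff)
      have k: "b2 * real p * (real p - 1) > 0" using b2 \<beta>2c_hump(1) p by simp
      have pos: "ell_d2 p b2 y > 0" if "hump x < hump y" "0 < y" "y < 1" for y
        using e mult_strict_left_mono[OF that(1) k] that by (simp add: ell_d2_neg_iff)
      consider "x < xc" | "x > xc" using \<open>x \<noteq> xc\<close> by linarith
      then show False
      proof cases
        case 1
        have "x \<notin> maximizers p b1 b2"
        proof (rule d1_mono_imp_not_maximizer[OF 1])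
          fix y assume y: "x < y" "y < xc"
          have "ell_d1 p b1 b2 x < ell_d1 p b1 b2 y"
            using y xi xc by (intro d1_strict_mono pos hump_increasing) auto
          then show "ell_d1 p b1 b2 y > 0" using maximizer_d1[OF x] by simp
        qed (use xc in auto)
        with x show False by simp
      next
        case 2
        have "x \<notin> maximizers p b1 b2"
        proof (rule d1_antimono_imp_not_maximizer[OF 2])
          fix y assume y: "xc < y" "y < x"
          have "ell_d1 p b1 b2 y < ell_d1 p b1 b2 x"
            using y xi xc by (intro d1_strict_mono pos hump_decreasing) auto
          then show "ell_d1 p b1 b2 y < 0" using maximizer_d1[OF x] by simp
        qed (use xc in auto)
        with x show False by simp
      qed
    qed
  qed
qed

section \<open>Dependence of the maximizers on the parameters\<close>

lemma maximizer_mono: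
  assumes x: "x \<in> maximizers p b1 b2" and y: "y \<in> maximizers p b1 b2'" and "b2 < b2'"
  shows "x \<le> y"
proof (rule ccontr)
  assume "\<not> x \<le> y"
  \<comment> \<open>Adding the two optimality inequalities cancels everything except
    \<open>(b2' - b2) * (x ^ p - y ^ p)\<close>, which they force to be nonpositive.\<close>
  have "y ^ p < x ^ p"
    using \<open>\<not> x \<le> y\<close> maximizer_interior[OF y] p by (intro power_strict_mono) auto
  then have "(b2' - b2) * (x ^ p - y ^ p) > 0" using assms(3) by simp
  moreover have "ell p b1 b2 y \<le> ell p b1 b2 x" "ell p b1 b2' x \<le> ell p b1 b2' y"
    using x y by (auto simp: mem_maximizers)
  ultimately show False by (simp add: ell_def algebra_simps)
qed

text \<open>The maximizers have a closed graph. Both parameters may move: \<beta>2 does in the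
  construction of the transition value, \<beta>1 in the differentiation of the limit.\<close>

lemma maximizer_limit:
  assumes "\<And>n. x n \<in> maximizers p (c n) (b n)" "b \<longlonglongrightarrow> b2" "c \<longlonglongrightarrow> b1" "x \<longlonglongrightarrow> z"
  shows "z \<in> maximizers p b1 b2"
proof -
  have x01: "x n \<in> {0..1}" for n using assms(1) by (auto simp: mem_maximizers)
  then have z: "z \<in> {0..1}" using assms(4) by (meson closed_atLeastAtMost closed_sequentially)
  have e: "(\<lambda>n. ell p (c n) (b n) (w n)) \<longlonglongrightarrow> ell p b1 b2 v" if w: "\<And>n. w n \<in> {0..1}" "w \<longlonglongrightarrow> v" for w v
  proof -
    have v: "v \<in> {0..1}" using w by (meson closed_atLeastAtMost closed_sequentially)
    \<comment> \<open>Splitting off the entropy reduces the claim to continuity of one fixed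
      function, although the parameters vary with \<open>n\<close>.\<close>
    have "(\<lambda>n. ell p 0 0 (w n)) \<longlonglongrightarrow> ell p 0 0 v"
      using continuous_on_tendsto_compose[OF continuous_on_ell w(2) v] w(1) by simp
    then have "(\<lambda>n. c n * w n + b n * w n ^ p + ell p 0 0 (w n)) \<longlonglongrightarrow> b1 * v + b2 * v ^ p + ell p 0 0 v"
      by (intro tendsto_intros assms w)
    then show ?thesis by (simp add: ell_def algebra_simps)
  qed
  have "ell p b1 b2 y \<le> ell p b1 b2 z" if y: "y \<in> {0..1}" for y
    using e[of "\<lambda>_. y" y] e[of x z] y x01 assms by (intro LIMSEQ_le) (auto simp: mem_maximizers)
  with z show ?thesis by (auto simp: mem_maximizers)
qed

lemma maximizer_limit_subseq:
  assumes "\<And>n. x n \<in> maximizers p (c n) (b n)" "b \<longlonglongrightarrow> b2" "c \<longlonglongrightarrow> b1"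
  obtains z r where "z \<in> maximizers p b1 b2" "strict_mono r" "(x \<circ> r) \<longlonglongrightarrow> z"
proof -
  have "x n \<in> {0..1}" for n using assms(1) by (auto simp: mem_maximizers)
  then obtain z r where r: "strict_mono r" "(x \<circ> r) \<longlonglongrightarrow> z"
    by (meson compact_Icc compact_imp_seq_compact seq_compactE)
  have "z \<in> maximizers p b1 b2"
    by (rule maximizer_limit[of "x \<circ> r" "c \<circ> r" "b \<circ> r"])
       (use assms r in \<open>auto intro: LIMSEQ_subseq_LIMSEQ\<close>)
  with r that show thesis by blast
qed

lemma maximizers_card_2_iff:
  "card (maximizers p b1 b2) = 2 \<longleftrightarrow> (\<exists>x1 x2. x1 < xc \<and> xc < x2 \<and> maximizers p b1 b2 = {x1, x2})"
proof
  assume "card (maximizers p b1 b2) = 2"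
  then obtain x y where xy: "maximizers p b1 b2 = {x, y}" "x \<noteq> y" by (auto simp: card_2_iff)
  then have "x \<in> maximizers p b1 b2" "y \<in> maximizers p b1 b2" by simp_all
  from maximizer_unique_half[OF this] xy(2) have "x < xc \<and> xc < y \<or> y < xc \<and> xc < x"
    by linarith
  moreover have "maximizers p b1 b2 = {y, x}" using xy(1) by auto
  ultimately show "\<exists>x1 x2. x1 < xc \<and> xc < x2 \<and> maximizers p b1 b2 = {x1, x2}"
    using xy(1) by blast
next
  assume "\<exists>x1 x2. x1 < xc \<and> xc < x2 \<and> maximizers p b1 b2 = {x1, x2}"
  then obtain x1 x2 where "x1 < xc" "xc < x2" "maximizers p b1 b2 = {x1, x2}" by blast
  then show "card (maximizers p b1 b2) = 2" using less_trans[of x1 xc x2] by auto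
qed

text \<open>Pigeonhole: among three maximizers two would lie in the same half of the
  interval.\<close>

lemma maximizers_cases:
  obtains x where "0 < x" "x < 1" "maximizers p b1 b2 = {x}" | "card (maximizers p b1 b2) = 2"
proof -
  obtain x where x: "x \<in> maximizers p b1 b2" using maximizers_nonempty by blast
  show ?thesis
  proof (cases "\<exists>y\<in>maximizers p b1 b2. y \<noteq> x")
    case True
    then obtain y where y: "y \<in> maximizers p b1 b2" "y \<noteq> x" by blast
    have "z = x \<or> z = y" if "z \<in> maximizers p b1 b2" for z
      using maximizer_unique_half[OF x that] maximizer_unique_half[OF y(1) that] maximizer_unique_half[OF x y(1)] y(2)
        linear[of x xc] linear[of y xc] linear[of z xc] by metis
    then have "maximizers p b1 b2 = {x, y}" using x y by blast
    then show ?thesis using that(2) y(2) by (auto simp: card_2_iff)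
  next
    case False
    then show ?thesis using that(1) x maximizer_interior[OF x] by blast
  qed
qed

text \<open>The smaller \<beta>2 would have a maximizer right of \<open>xc\<close> and the larger
  one a maximizer left of it, against monotonicity in \<beta>2.\<close>

lemma card_2_unique:
  assumes "card (maximizers p b1 b2) = 2" "card (maximizers p b1 b2') = 2"
  shows "b2 = b2'"
proof -
  have *: False if b: "b2 < b2'" "card (maximizers p b1 b2) = 2" "card (maximizers p b1 b2') = 2" for b2 b2'
  proof -
    obtain x where "xc < x" "x \<in> maximizers p b1 b2"
      using b(2) unfolding maximizers_card_2_iff by blast
    moreover obtain y where "y < xc" "y \<in> maximizers p b1 b2'"
      using b(3) unfolding maximizers_card_2_iff by blast
    ultimately show False using maximizer_mono[of x b1 b2 y b2'] b(1) by linarith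
  qed
  show ?thesis using *[of b2 b2'] *[of b2' b2] assms by (cases b2 b2' rule: linorder_cases) auto
qed

text \<open>Up to \<beta>2c the function \<open>ell_d1\<close> is strictly decreasing and has at
  most one zero. Beyond it, \<open>b1 \<ge> \<beta>1c p\<close> puts the maximizer for \<beta>2c at
  \<open>xc\<close> or to its right, and monotonicity then leaves none to the left.\<close>

lemma card_2_imp_b1_less:
  assumes "card (maximizers p b1 b2) = 2"
  shows "b1 < \<beta>1c p"
proof (rule ccontr)
  assume "\<not> b1 < \<beta>1c p"
  obtain x1 x2 where x: "x1 < xc" "xc < x2" "x1 \<in> maximizers p b1 b2" "x2 \<in> maximizers p b1 b2"
    using assms unfolding maximizers_card_2_iff by blast
  have b2: "b2 > \<beta>2c p"
  proof (rule ccontr)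
    assume "\<not> b2 > \<beta>2c p"
    have d1: "ell_d1 p b1 b2 v < ell_d1 p b1 b2 u" if "0 < u" "u < v" "v < 1" "v \<le> xc \<or> xc \<le> u" for u v
      using \<open>\<not> b2 > \<beta>2c p\<close> that by (intro d1_strict_antimono ell_d2_neg) auto
    have "ell_d1 p b1 b2 xc < ell_d1 p b1 b2 x1" "ell_d1 p b1 b2 x2 < ell_d1 p b1 b2 xc"
      using x xc maximizer_interior[OF x(3)] maximizer_interior[OF x(4)] by (auto intro!: d1)
    then show False using maximizer_d1[OF x(3)] maximizer_d1[OF x(4)] by simp
  qed
  obtain y where y: "y \<in> maximizers p b1 (\<beta>2c p)" using maximizers_nonempty by blast
  have "y \<ge> xc"
  proof (rule ccontr)
    assume "\<not> y \<ge> xc"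
    then have "ell_d1 p b1 (\<beta>2c p) xc < ell_d1 p b1 (\<beta>2c p) y"
      using xc maximizer_interior[OF y] by (intro d1_strict_antimono ell_d2_neg) auto
    then show False using \<open>\<not> b1 < \<beta>1c p\<close> maximizer_d1[OF y] by (simp add: ell_d1_xc)
  qed
  then show False using maximizer_mono[OF y x(3) b2] x(1) by simp
qed

lemma maximizer_less_xc:
  assumes "b1 < \<beta>1c p" "b2 \<le> \<beta>2c p" "x \<in> maximizers p b1 b2"
  shows "x < xc"
proof (rule ccontr)
  assume "\<not> x < xc"
  have "ell_d1 p b1 b2 xc < 0"
    unfolding ell_d1_xc using assms(1,2) xc
    by (smt (verit) mult_nonneg_nonneg mult_nonpos_nonneg of_nat_0_le_iff zero_le_power)
  moreover have "ell_d1 p b1 b2 x \<le> ell_d1 p b1 b2 xc"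
  proof (cases "x = xc")
    case False
    then show ?thesis
      using \<open>\<not> x < xc\<close> xc assms(2) maximizer_interior[OF assms(3)]
      by (intro less_imp_le d1_strict_antimono ell_d2_neg) auto
  qed simp
  ultimately show False using maximizer_d1[OF assms(3)] by simp
qed

lemma maximizer_greater_xc:
  obtains b2 where "\<And>x. x \<in> maximizers p b1 b2 \<Longrightarrow> xc < x"
proof -
  define q where "q = 1 - xc ^ p"
  have q: "q > 0" using xc p by (simp add: q_def power_less_one_iff)
  \<comment> \<open>In the comparison with the value at 1, the linear term costs at most
    \<open>\<bar>b1\<bar>\<close> and the entropy at most 1; the remaining 1 makes the inequality
    strict.\<close>
  define b2 where "b2 = (\<bar>b1\<bar> + 2) / q"
  have "xc < x" if x: "x \<in> maximizers p b1 b2" for x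
  proof (rule ccontr)
    assume "\<not> xc < x"
    note xi = maximizer_interior[OF x]
    have "x ^ p \<le> xc ^ p" using \<open>\<not> xc < x\<close> xi by (intro power_mono) auto
    then have "b2 * (1 - x ^ p) \<ge> b2 * q"
      using q unfolding b2_def q_def by (intro mult_left_mono) auto
    also have "b2 * q = \<bar>b1\<bar> + 2" using q by (simp add: b2_def)
    finally have 1: "b2 * (1 - x ^ p) \<ge> \<bar>b1\<bar> + 2" .
    have ln_le: "- y * ln y \<le> 1 - y" if "0 < y" for y :: real
      using ln_le_minus_one[of "1 / y"] that by (simp add: ln_div field_simps)
    have 2: "- x * ln x - (1 - x) * ln (1 - x) \<le> 1"
      using ln_le[of x] ln_le[of "1 - x"] xi by (simp add: algebra_simps)
    have "\<bar>b1 * (1 - x)\<bar> \<le> \<bar>b1\<bar> * 1"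
      unfolding abs_mult using xi by (intro mult_left_mono) auto
    then have 3: "b1 * (1 - x) \<ge> - \<bar>b1\<bar>" by linarith
    have "ell p b1 b2 1 \<le> ell p b1 b2 x" using x by (auto simp: mem_maximizers)
    with 1 2 3 show False by (simp add: ell_def algebra_simps)
  qed
  with that show ?thesis by blast
qed

text \<open>The transition value is the supremum of all \<open>b2\<close> which have a maximizer left of \<open>xc\<close>; there
  the maximizers approaching from both sides survive by compactness.\<close>

lemma card_2_exists:
  assumes b1: "b1 < \<beta>1c p"
  shows "\<exists>b2. card (maximizers p b1 b2) = 2"
proof -
  define S where "S = {b2. \<exists>x\<in>maximizers p b1 b2. x \<le> xc}"
  have "\<beta>2c p \<in> S"
    using maximizer_less_xc[OF b1 order_refl] maximizers_nonempty[of b1 "\<beta>2c p"] by (fastforce simp: S_def)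
  obtain B where B: "\<And>x. x \<in> maximizers p b1 B \<Longrightarrow> xc < x"
    using maximizer_greater_xc by blast
  have "b \<le> B" if b: "b \<in> S" for b
  proof (rule ccontr)
    assume "\<not> b \<le> B"
    obtain x where "x \<le> xc" "x \<in> maximizers p b1 b" using b by (auto simp: S_def)
    moreover obtain y where "y \<in> maximizers p b1 B" using maximizers_nonempty by blast
    ultimately show False using maximizer_mono[of y b1 B x b] B[of y] \<open>\<not> b \<le> B\<close> by simp
  qed
  then have bdd: "bdd_above S" by (rule bdd_aboveI)
  define s where "s = Sup S"
  have s: "s \<ge> \<beta>2c p" unfolding s_def using \<open>\<beta>2c p \<in> S\<close> bdd by (rule cSup_upper)
  obtain z1 where z1: "z1 \<in> maximizers p b1 s" "z1 \<le> xc"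
  proof -
    have "\<exists>b\<in>S. b > s - 1 / real (Suc n)" for n
      using less_cSupD[of S "s - 1 / real (Suc n)"] \<open>\<beta>2c p \<in> S\<close> by (auto simp: s_def)
    then obtain b where b: "\<And>n. b n \<in> S" "\<And>n. b n > s - 1 / real (Suc n)" by metis
    have "\<forall>n. \<exists>x. x \<in> maximizers p b1 (b n) \<and> x \<le> xc" using b(1) by (auto simp: S_def)
    then obtain x where x: "\<And>n. x n \<in> maximizers p b1 (b n)" "\<And>n. x n \<le> xc" by metis
    have "b \<longlonglongrightarrow> s"
    proof (rule tendsto_sandwich[of "\<lambda>n. s - 1 / real (Suc n)" _ _ "\<lambda>_. s"])
      show "(\<lambda>n. s - 1 / real (Suc n)) \<longlonglongrightarrow> s" by real_asymp
      show "\<forall>\<^sub>F n in sequentially. b n \<le> s"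
        using b(1) bdd by (auto simp: s_def intro!: always_eventually cSup_upper)
    qed (use b(2) in \<open>auto intro: always_eventually less_imp_le\<close>)
    then obtain z r where "z \<in> maximizers p b1 s" "(x \<circ> r) \<longlonglongrightarrow> z"
      by (rule maximizer_limit_subseq[where c = "\<lambda>_. b1", OF x(1) _ tendsto_const])
    moreover from this(2) have "z \<le> xc" using x(2) by (intro LIMSEQ_le_const2[of "x \<circ> r"]) auto
    ultimately show ?thesis using that by blast
  qed
  obtain z2 where z2: "z2 \<in> maximizers p b1 s" "z2 \<ge> xc"
  proof -
    define b where "b n = s + 1 / real (Suc n)" for n
    have "b n \<notin> S" for n
      using cSup_upper[of "b n" S] bdd by (auto simp: b_def s_def not_le)
    then have "\<forall>n. \<exists>x. x \<in> maximizers p b1 (b n) \<and> x \<ge> xc"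
      using maximizers_nonempty by (fastforce simp: S_def)
    then obtain x where x: "\<And>n. x n \<in> maximizers p b1 (b n)" "\<And>n. x n \<ge> xc" by metis
    have "b \<longlonglongrightarrow> s" unfolding b_def by real_asymp
    then obtain z r where "z \<in> maximizers p b1 s" "(x \<circ> r) \<longlonglongrightarrow> z"
      by (rule maximizer_limit_subseq[where c = "\<lambda>_. b1", OF x(1) _ tendsto_const])
    moreover from this(2) have "z \<ge> xc" using x(2) by (intro LIMSEQ_le_const[of "x \<circ> r"]) auto
    ultimately show ?thesis using that by blast
  qed
  \<comment> \<open>As \<open>s \<ge> \<beta>2c p\<close>, a maximizer at \<open>xc\<close> would
    force equality and with it \<open>b1 = \<beta>1c p\<close>. Hence the two limits are different
    points.\<close>
  have "xc \<notin> maximizers p b1 s"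
  proof
    assume "xc \<in> maximizers p b1 s"
    from maximizer_xc[OF this] s b1 show False by simp
  qed
  then have "z1 \<noteq> z2" using z1 z2 by auto
  then have "card (maximizers p b1 s) = 2"
    using z1(1) z2(1) by (cases rule: maximizers_cases[of b1 s]) auto
  then show ?thesis ..
qed

text \<open>Gives the definite description in \<open>q\<close> its meaning through existence and
  uniqueness for \<open>b1 < \<beta>1c p\<close>. Two maximizers never occur for larger \<beta>1,
  which leaves only the prescribed endpoint.\<close>

lemma phase_curve_iff:
  "(b1, b2) \<in> phase_curve p \<longleftrightarrow> card (maximizers p b1 b2) = 2 \<or> (b1, b2) = (\<beta>1c p, \<beta>2c p)"
proof (cases "b1 < \<beta>1c p")
  case True
  then obtain b where b: "card (maximizers p b1 b) = 2" using card_2_exists by blast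
  then have "(THE b2. card (maximizers p b1 b2) = 2) = b"
    by (rule the_equality) (rule card_2_unique[OF _ b])
  then have "q p b1 = b" using True by (simp add: q_def)
  then have "(b1, b2) \<in> phase_curve p \<longleftrightarrow> b2 = b" using True by (simp add: phase_curve_def)
  also have "\<dots> \<longleftrightarrow> card (maximizers p b1 b2) = 2"
    using b card_2_unique[OF _ b] by metis
  finally show ?thesis using True by simp
next
  case False
  then have "card (maximizers p b1 b2) \<noteq> 2" using card_2_imp_b1_less by metis
  then show ?thesis using False by (auto simp: phase_curve_def q_def)
qed

text \<open>\<open>ell_d1\<close> vanishes at \<open>xc\<close> and decreases strictly on either
  side; the sides are treated apart because the second derivative is 0 at \<open>xc\<close>
  itself.\<close>

lemma critical_maximizers: "maximizers p (\<beta>1c p) (\<beta>2c p) = {xc}"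
proof -
  have "x = xc" if x: "x \<in> maximizers p (\<beta>1c p) (\<beta>2c p)" for x
  proof -
    note xi = maximizer_interior[OF x]
    have "ell_d1 p (\<beta>1c p) (\<beta>2c p) xc < ell_d1 p (\<beta>1c p) (\<beta>2c p) x" if "x < xc"
      using that xi xc by (intro d1_strict_antimono ell_d2_neg) auto
    moreover have "ell_d1 p (\<beta>1c p) (\<beta>2c p) x < ell_d1 p (\<beta>1c p) (\<beta>2c p) xc" if "xc < x"
      using that xi xc by (intro d1_strict_antimono ell_d2_neg) auto
    ultimately show ?thesis using maximizer_d1[OF x] by (simp add: ell_d1_xc) argo
  qed
  then show ?thesis using maximizers_nonempty by blast
qed

end

section \<open>Moments at one and at two maximizers\<close>

lemma integrable_power_exp:
  assumes "c > 0" "even m" "m > 0" "j \<le> 2"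
  shows "integrable lborel (\<lambda>y::real. exp (- c * y ^ m) * y ^ j)"
proof -
  obtain B where B: "B > 0" "\<And>(t::real) (j::nat). j \<le> 2 \<Longrightarrow> exp (- c * t ^ m) * \<bar>t\<bar> ^ j \<le> B / (1 + t\<^sup>2)"
    using exp_neg_power_bound[of c m] assms by auto
  have "integrable lborel (\<lambda>y::real. B * (1 / (1 + y\<^sup>2)))"
    by (intro integrable_mult_right integrable_inverse_1_plus_sq)
  then show ?thesis
  proof (rule Bochner_Integration.integrable_bound)
    show "AE y in lborel. norm (exp (- c * y ^ m) * y ^ j) \<le> norm (B * (1 / (1 + y\<^sup>2)))"
    proof (rule AE_I2)
      fix y :: real
      have "B / (1 + y\<^sup>2) \<ge> 0" using B(1) by (simp add: add_nonneg_nonneg)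
      then show "norm (exp (- c * y ^ m) * y ^ j) \<le> norm (B * (1 / (1 + y\<^sup>2)))"
        using B(1) B(2)[OF assms(4), of y] by (simp add: abs_mult power_abs)
    qed
  qed measurable
qed

lemma power_exp_integral_1:
  assumes "c > 0" "even m" "m > 0"
  shows "power_exp_integral m c 1 = 0"
proof -
  let ?f = "\<lambda>y::real. exp (- c * y ^ m) * y ^ 1"
  have "has_bochner_integral lborel (\<lambda>x. indicator {0..} x *\<^sub>R ?f x) (\<integral>x. indicator {0..} x *\<^sub>R ?f x \<partial>lborel)"
    using integrable_power_exp[OF assms, of 1]
    by (intro has_bochner_integral_integrable integrable_mult_indicator) auto
  from has_bochner_integral_odd_function[OF this] show ?thesis
    using assms unfolding power_exp_integral_def by (simp add: has_bochner_integral_integral_eq)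
qed

text \<open>The substitution \<open>t = c * y ^ m\<close> turns the integral over the positive
  half-line into the integral of \<open>Gamma s\<close>, and evenness doubles it.\<close>

lemma power_exp_integral_even:
  assumes c: "c > 0" and m: "even m" "m > 0" and j: "even j" "j \<le> 2"
  defines "s \<equiv> (real j + 1) / real m"
  shows "power_exp_integral m c j = 2 / real m * c powr (- s) * Gamma s"
proof -
  let ?f = "\<lambda>y::real. exp (- c * y ^ m) * y ^ j"
  have s: "s > 0" using m by (simp add: s_def)
  define F where "F t = t powr (s - 1) / exp t" for t :: real
  define g where "g y = c * y ^ m" for y
  define g' where "g' y = c * (real m * y ^ (m - 1))" for y
  have g_img: "g ` {0<..} = {0<..}"
  proof (intro equalityI subsetI)
    fix t :: real assume t: "t \<in> {0<..}"
    have "g (root m (t / c)) = t" using t c m by (simp add: g_def)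
    moreover have "root m (t / c) > 0" using t c m by simp
    ultimately show "t \<in> g ` {0<..}" by (metis greaterThan_iff image_eqI)
  qed (use c in \<open>auto simp: g_def\<close>)
  have "(F has_integral Gamma s) {0..}"
    unfolding F_def using Gamma_integral_real[OF s] .
  \<comment> \<open>The endpoint is a null set; without it the substitution is a bijection of the
    half-line on which the laws of real powers hold.\<close>
  then have F: "(F has_integral Gamma s) {0<..}"
    by (subst has_integral_spike_set_eq[of _ "{0..}"]) (auto intro: negligible_subset[of "{0}"])
  then have "F absolutely_integrable_on {0<..}"
    by (intro nonnegative_absolutely_integrable_1) (auto simp: F_def has_integral_integrable_integral)
  then have "F absolutely_integrable_on g ` {0<..} \<and> integral (g ` {0<..}) F = Gamma s"
    using F by (simp add: g_img has_integral_integrable_integral)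
  moreover have "inj_on g {0<..}"
    using c m by (auto simp: inj_on_def g_def power_eq_iff_eq_base)
  moreover have "(g has_field_derivative g' y) (at y within {0<..})" for y
    unfolding g_def[abs_def] g'_def by (auto intro!: derivative_eq_intros)
  ultimately have "integral {0<..} (\<lambda>y. \<bar>g' y\<bar> * F (g y)) = Gamma s"
    using has_absolute_integral_change_of_variables_1'[of "{0<..}" g g' F "Gamma s"] by auto
  moreover have "\<bar>g' y\<bar> * F (g y) = (real m * c powr s) * ?f y" if y: "y > 0" for y
  proof -
    have "(c * y ^ m) powr (s - 1) = c powr (s - 1) * y powr (real m * (s - 1))"
      using y c by (simp add: powr_mult powr_powr flip: powr_realpow)
    also have "real m * (s - 1) = real j - real (m - 1)"
      using m by (simp add: s_def field_simps of_nat_diff)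
    also have "y powr (real j - real (m - 1)) = y ^ j / y ^ (m - 1)"
      using y by (simp only: powr_diff powr_realpow)
    finally have "\<bar>g' y\<bar> * F (g y) = c * (real m * y ^ (m - 1)) * (c powr (s - 1) * (y ^ j / y ^ (m - 1)) / exp (c * y ^ m))"
      using y c by (simp add: g'_def F_def g_def)
    also have "\<dots> = real m * (c * c powr (s - 1)) * (exp (- c * y ^ m) * y ^ j)"
      using y by (simp add: exp_minus field_simps)
    also have "c * c powr (s - 1) = c powr s"
      using c by (simp add: powr_diff)
    finally show ?thesis .
  qed
  ultimately have "integral {0<..} (\<lambda>y. (real m * c powr s) * ?f y) = Gamma s"
    by (metis (mono_tags, lifting) greaterThan_iff integral_cong)
  then have "(real m * c powr s) * integral {0<..} ?f = Gamma s"
    by (simp only: integral_mult_right)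
  then have I: "integral {0<..} ?f = Gamma s / (real m * c powr s)"
    using c m by (simp add: eq_divide_eq mult.commute)
  have int: "integrable lborel (\<lambda>x. indicator {0..} x *\<^sub>R ?f x)"
    using integrable_power_exp[OF c m j(2)] by (intro integrable_mult_indicator) auto
  have "(\<integral>x. indicator {0..} x *\<^sub>R ?f x \<partial>lborel) = integral UNIV (\<lambda>x. indicator {0..} x *\<^sub>R ?f x)"
    using integral_lborel[OF int] ..
  also have "\<dots> = integral UNIV (\<lambda>x. if x \<in> {0..} then ?f x else 0)"
    by (intro arg_cong[where f = "integral UNIV"]) (auto simp: indicator_def)
  also have "\<dots> = integral {0..} ?f"
    by (rule integral_restrict_UNIV)
  also have "\<dots> = integral {0<..} ?f"
    by (rule integral_spike_set) (auto intro: negligible_subset[of "{0}"])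
  finally have "has_bochner_integral lborel (\<lambda>x. indicator {0..} x *\<^sub>R ?f x) (Gamma s / (real m * c powr s))"
    using has_bochner_integral_integrable[OF int] I by simp
  from has_bochner_integral_even_function[OF this] m j
  have "power_exp_integral m c j = 2 * (Gamma s / (real m * c powr s))"
    unfolding power_exp_integral_def by (simp add: has_bochner_integral_integral_eq)
  then show ?thesis by (simp add: powr_minus_divide)
qed

lemma power_exp_integral_0_pos:
  assumes "c > 0" "even m" "m > 0"
  shows "power_exp_integral m c 0 > 0"
  using assms by (simp add: power_exp_integral_even Gamma_real_pos)

text \<open>The order of magnitude of the mass of a peak: \<open>scale m n\<close> lattice points,
  each of weight about \<open>exp (n * M) / sqrt n\<close>.\<close>

definition norm_const :: "nat \<Rightarrow> nat \<Rightarrow> real \<Rightarrow> real" where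
  "norm_const m n M = scale m n * exp (real n * M) / sqrt (real n)"

lemma scale_ge_1: "n > 0 \<Longrightarrow> m > 0 \<Longrightarrow> scale m n \<ge> 1"
  unfolding scale_def by (intro ge_one_powr_ge_zero) auto

lemma norm_const_pos: "n > 0 \<Longrightarrow> m > 0 \<Longrightarrow> norm_const m n M > 0"
  using scale_ge_1[of n m] by (simp add: norm_const_def)

text \<open>By compactness \<open>ell\<close> stays a fixed amount \<eta> below its maximum away
  from the maximizers, and \<open>exp (- \<eta> * n)\<close> outweighs the at most
  \<open>n + 1\<close> terms with polynomial factors. The bound on \<open>h\<close> leaves room for
  the rescaled moments and for powers of \<open>k / n - x\<close> alike.\<close>

lemma tail_negligible:
  assumes p: "p \<ge> 2" and m: "m > 0" and \<delta>: "\<delta> > 0" and x0: "x0 \<in> maximizers p b1 b2"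
    and h: "\<And>n k. n > 0 \<Longrightarrow> k \<le> n \<Longrightarrow> \<bar>h n k\<bar> \<le> real n ^ 2"
  shows "(\<lambda>n. (\<Sum>k | k \<le> n \<and> (\<forall>x\<in>maximizers p b1 b2. \<bar>real k / real n - x\<bar> \<ge> \<delta>). wt p n b1 b2 k * h n k)
            / norm_const m n (ell p b1 b2 x0)) \<longlonglongrightarrow> 0"
proof -
  define M where "M = ell p b1 b2 x0"
  define T where "T = {y\<in>{0..1}. \<forall>x\<in>maximizers p b1 b2. \<bar>y - x\<bar> \<ge> \<delta>}"
  obtain \<eta> where \<eta>: "\<eta> > 0" "\<And>y. y \<in> T \<Longrightarrow> ell p b1 b2 y \<le> M - \<eta>"
  proof (cases "T = {}")
    case True
    then show ?thesis using that[of 1] by simp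
  next
    case False
    have "T = {0..1} \<inter> (\<Inter>x\<in>maximizers p b1 b2. {y. \<bar>y - x\<bar> \<ge> \<delta>})" by (auto simp: T_def)
    moreover have "closed (\<Inter>x\<in>maximizers p b1 b2. {y. \<bar>y - x\<bar> \<ge> \<delta>})"
      by (intro closed_INT ballI closed_Collect_le continuous_intros)
    ultimately have "compact T" by (simp add: compact_Int_closed)
    moreover have "continuous_on T (ell p b1 b2)"
      by (rule continuous_on_subset[OF continuous_on_ell[OF p]]) (auto simp: T_def)
    ultimately obtain z where z: "z \<in> T" "\<And>y. y \<in> T \<Longrightarrow> ell p b1 b2 y \<le> ell p b1 b2 z"
      using continuous_attains_sup[of T] False by metis
    have "z \<notin> maximizers p b1 b2" using z(1) \<delta> by (auto simp: T_def)
    then have "ell p b1 b2 z < M"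
      using z(1) x0 mem_maximizers[OF p] unfolding T_def M_def
      by (smt (verit, best) mem_Collect_eq)
    then show ?thesis using that[of "M - ell p b1 b2 z"] z(2) by auto
  qed
  show ?thesis
  proof (rule Lim_null_comparison)
    show "(\<lambda>n. (real n + 1) * real n ^ 2 * sqrt (real n) * exp (- \<eta> * real n)) \<longlonglongrightarrow> 0"
      using \<eta>(1) by real_asymp
    show "\<forall>\<^sub>F n in sequentially. norm ((\<Sum>k | k \<le> n \<and> (\<forall>x\<in>maximizers p b1 b2. \<bar>real k / real n - x\<bar> \<ge> \<delta>). wt p n b1 b2 k * h n k)
            / norm_const m n (ell p b1 b2 x0)) \<le> (real n + 1) * real n ^ 2 * sqrt (real n) * exp (- \<eta> * real n)"
    proof (rule eventually_mono[OF eventually_gt_at_top[of 0]])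
      fix n :: nat assume n: "n > 0"
      let ?K = "{k. k \<le> n \<and> (\<forall>x\<in>maximizers p b1 b2. \<bar>real k / real n - x\<bar> \<ge> \<delta>)}"
      have "\<bar>\<Sum>k\<in>?K. wt p n b1 b2 k * h n k\<bar> \<le> (\<Sum>k\<in>?K. exp (real n * (M - \<eta>)) * real n ^ 2)"
      proof (rule order_trans[OF sum_abs], rule sum_mono)
        fix k assume k: "k \<in> ?K"
        have "real k / real n \<in> T" using k n by (auto simp: T_def field_simps)
        then have "exp (real n * ell p b1 b2 (real k / real n)) \<le> exp (real n * (M - \<eta>))"
          using \<eta>(2) by (simp add: mult_left_mono)
        then have "wt p n b1 b2 k \<le> exp (real n * (M - \<eta>))"
          using wt_le_exp[of k n p b1 b2] k n by (auto intro: order_trans)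
        then show "\<bar>wt p n b1 b2 k * h n k\<bar> \<le> exp (real n * (M - \<eta>)) * real n ^ 2"
          unfolding abs_mult using k n h[of n k] wt_nonneg[of p n b1 b2 k] by (intro mult_mono) auto
      qed
      also have "\<dots> \<le> (real n + 1) * (exp (real n * (M - \<eta>)) * real n ^ 2)"
      proof -
        have "card ?K \<le> card {..n}" by (rule card_mono) auto
        then have "real (card ?K) \<le> real n + 1" by simp
        then show ?thesis by (simp add: mult_right_mono)
      qed
      finally have "\<bar>\<Sum>k\<in>?K. wt p n b1 b2 k * h n k\<bar> \<le> (real n + 1) * (exp (real n * (M - \<eta>)) * real n ^ 2)" .
      moreover have "exp (real n * M) / sqrt (real n) \<le> norm_const m n M"
        using scale_ge_1[OF n m] n by (simp add: norm_const_def divide_right_mono)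
      ultimately have "\<bar>\<Sum>k\<in>?K. wt p n b1 b2 k * h n k\<bar> / norm_const m n M
          \<le> (real n + 1) * (exp (real n * (M - \<eta>)) * real n ^ 2) / (exp (real n * M) / sqrt (real n))"
        using n by (intro frac_le) auto
      also have "\<dots> = (real n + 1) * real n ^ 2 * sqrt (real n) * exp (- \<eta> * real n)"
        by (simp add: exp_diff exp_minus right_diff_distrib field_simps)
      finally show "norm ((\<Sum>k\<in>?K. wt p n b1 b2 k * h n k) / norm_const m n (ell p b1 b2 x0))
         \<le> (real n + 1) * real n ^ 2 * sqrt (real n) * exp (- \<eta> * real n)"
        using norm_const_pos[OF n m, of "ell p b1 b2 x0"] by (simp add: M_def)
    qed
  qed
qed

text \<open>The moments of orders 0, 1 and 2 share a normalisation, which cancels in the quotients.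
  The limit density is even, so the mean drops out of the variance.\<close>

lemma d2psi_unique_maximizer:
  assumes p: "p \<ge> 2" and max: "maximizers p b1 b2 = {x0}"
    and m: "even m" "m > 0" and c: "c > 0"
    and L: "((\<lambda>x. (ell p b1 b2 x - ell p b1 b2 x0) / (x - x0) ^ m) \<longlongrightarrow> - c) (at x0)"
  shows "(\<lambda>n. d2psi p n b1 b2 * real n / (scale m n)\<^sup>2) \<longlonglongrightarrow> power_exp_integral m c 2 / power_exp_integral m c 0"
proof -
  let ?M = "ell p b1 b2 x0" and ?G = "power_exp_integral m c"
  have x0: "0 < x0" "x0 < 1" using maximizer_interior[OF p, of x0 b1 b2] max by auto
  define D where "D = stirling_const * sqrt (x0 * (1 - x0))"
  have D: "D > 0" using x0 stirling_const(1) by (simp add: D_def)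
  obtain \<delta> where \<delta>: "\<delta> > 0" and loc: "\<And>j. j \<le> 2 \<Longrightarrow>
      (\<lambda>n. (\<Sum>k | k \<le> n \<and> \<bar>real k / real n - x0\<bar> < \<delta>. wt p n b1 b2 k * ((real k - real n * x0) / scale m n) ^ j)
             / norm_const m n ?M) \<longlonglongrightarrow> ?G j / D"
    using eventually_happens[OF eventually_conj[OF local_laplace[OF x0 m c L] eventually_at_right_less[of 0]]]
    unfolding norm_const_def D_def by auto
  have mom: "(\<lambda>n. moment p n b1 b2 (real n * x0) j / scale m n ^ j / norm_const m n ?M) \<longlonglongrightarrow> ?G j / D" if j: "j \<le> 2" for j
  proof -
    have "(\<lambda>n. (\<Sum>k | k \<le> n \<and> (\<forall>x\<in>maximizers p b1 b2. \<bar>real k / real n - x\<bar> \<ge> \<delta>). wt p n b1 b2 k * ((real k - real n * x0) / scale m n) ^ j)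
            / norm_const m n ?M) \<longlonglongrightarrow> 0"
    proof (rule tail_negligible[OF p m(2) \<delta>])
      fix n k :: nat assume n: "n > 0" "k \<le> n"
      have "0 \<le> real n * x0" "real n * x0 \<le> real n" "real k \<le> real n"
        using n x0 by (auto simp: mult_left_le)
      then have "\<bar>real k - real n * x0\<bar> \<le> real n" by linarith
      then have "\<bar>(real k - real n * x0) / scale m n\<bar> \<le> real n / 1"
        unfolding abs_divide using scale_ge_1[OF n(1) m(2)] by (intro frac_le) auto
      then have "\<bar>(real k - real n * x0) / scale m n\<bar> \<le> real n" by simp
      then have "\<bar>(real k - real n * x0) / scale m n\<bar> ^ j \<le> real n ^ j"
        by (intro power_mono) auto
      also have "\<dots> \<le> real n ^ 2" using n j by (intro power_increasing) auto
      finally show "\<bar>((real k - real n * x0) / scale m n) ^ j\<bar> \<le> real n ^ 2" by (simp add: power_abs)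
    qed (simp add: max)
    from tendsto_add[OF loc[OF j] this]
    have "(\<lambda>n. (\<Sum>k\<le>n. wt p n b1 b2 k * ((real k - real n * x0) / scale m n) ^ j) / norm_const m n ?M) \<longlonglongrightarrow> ?G j / D"
    proof (simp only: add_0_right, elim Lim_transform_eventually, intro always_eventually allI)
      fix n
      have "{..n} = {k. k \<le> n \<and> \<bar>real k / real n - x0\<bar> < \<delta>} \<union> {k. k \<le> n \<and> (\<forall>x\<in>maximizers p b1 b2. \<bar>real k / real n - x\<bar> \<ge> \<delta>)}"
        by (auto simp: max)
      moreover have "{k. k \<le> n \<and> \<bar>real k / real n - x0\<bar> < \<delta>} \<inter> {k. k \<le> n \<and> (\<forall>x\<in>maximizers p b1 b2. \<bar>real k / real n - x\<bar> \<ge> \<delta>)} = {}"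
        by (auto simp: max)
      ultimately show "(\<Sum>k | k \<le> n \<and> \<bar>real k / real n - x0\<bar> < \<delta>. wt p n b1 b2 k * ((real k - real n * x0) / scale m n) ^ j) / norm_const m n ?M
        + (\<Sum>k | k \<le> n \<and> (\<forall>x\<in>maximizers p b1 b2. \<bar>real k / real n - x\<bar> \<ge> \<delta>). wt p n b1 b2 k * ((real k - real n * x0) / scale m n) ^ j) / norm_const m n ?M
        = (\<Sum>k\<le>n. wt p n b1 b2 k * ((real k - real n * x0) / scale m n) ^ j) / norm_const m n ?M"
        by (subst \<open>{..n} = _\<close>, subst sum.union_disjoint) (auto simp: add_divide_distrib)
    qed
    then show ?thesis
      by (simp add: moment_def power_divide sum_divide_distrib)
  qed
  have "?G 0 / D \<noteq> 0" using power_exp_integral_0_pos[OF c m] D by simp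
  have "(\<lambda>n. moment p n b1 b2 (real n * x0) 2 / scale m n ^ 2 / norm_const m n ?M / (W p n b1 b2 / norm_const m n ?M)
      - (moment p n b1 b2 (real n * x0) 1 / scale m n ^ 1 / norm_const m n ?M / (W p n b1 b2 / norm_const m n ?M))\<^sup>2)
      \<longlonglongrightarrow> ?G 2 / D / (?G 0 / D) - (?G 1 / D / (?G 0 / D))\<^sup>2"
  proof -
    have W: "(\<lambda>n. W p n b1 b2 / norm_const m n ?M) \<longlonglongrightarrow> ?G 0 / D"
      using mom[of 0] by (simp add: moment_0)
    show ?thesis
      by (rule tendsto_diff[OF tendsto_divide[OF mom[OF order_refl] W]
            tendsto_power[OF tendsto_divide[OF mom[OF one_le_numeral] W]]]) fact+
  qed
  also have "?G 2 / D / (?G 0 / D) - (?G 1 / D / (?G 0 / D))\<^sup>2 = ?G 2 / ?G 0"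
    using power_exp_integral_1[OF c m] D by simp
  finally show ?thesis
  proof (rule Lim_transform_eventually)
    show "\<forall>\<^sub>F n in sequentially. moment p n b1 b2 (real n * x0) 2 / scale m n ^ 2 / norm_const m n ?M / (W p n b1 b2 / norm_const m n ?M)
      - (moment p n b1 b2 (real n * x0) 1 / scale m n ^ 1 / norm_const m n ?M / (W p n b1 b2 / norm_const m n ?M))\<^sup>2
      = d2psi p n b1 b2 * real n / (scale m n)\<^sup>2"
    proof (rule eventually_mono[OF eventually_gt_at_top[of 0]])
      fix n :: nat assume n: "n > 0"
      have *: "A / s ^ 2 / N / (w / N) - (B / s ^ 1 / N / (w / N))\<^sup>2 = (A / w - (B / w)\<^sup>2) / s\<^sup>2"
        if "N \<noteq> 0" for A B s N w :: real
        using that by (simp add: power_divide diff_divide_distrib power_mult_distrib mult.commute)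
      show "moment p n b1 b2 (real n * x0) 2 / scale m n ^ 2 / norm_const m n ?M / (W p n b1 b2 / norm_const m n ?M)
        - (moment p n b1 b2 (real n * x0) 1 / scale m n ^ 1 / norm_const m n ?M / (W p n b1 b2 / norm_const m n ?M))\<^sup>2
        = d2psi p n b1 b2 * real n / (scale m n)\<^sup>2"
        using norm_const_pos[OF n m(2), of ?M] n
        by (subst *) (simp_all add: d2psi_eq_variance[OF n, of p b1 b2 "real n * x0"])
    qed
  qed
qed

lemma scale_2: "scale 2 n = sqrt (real n)"
  by (simp add: scale_def powr_half_sqrt)

lemma power_exp_integral_2_0:
  assumes "c > 0"
  shows "power_exp_integral 2 c 0 = Gamma (1/2) / sqrt c"
  using assms by (simp add: power_exp_integral_even powr_minus_divide powr_half_sqrt)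

text \<open>Seen at the scale of \<open>k / n\<close>, each peak shrinks to a point, and the law
  tends to one on \<open>x1\<close> and \<open>x2\<close> with weights proportional to
  \<open>g1\<close> and \<open>g2\<close>. The limit is the variance of that law; fluctuations
  within a peak vanish.\<close>

lemma d2psi_two_maximizers:
  assumes p: "p \<ge> 2" and max: "maximizers p b1 b2 = {x1, x2}" "x1 \<noteq> x2"
    and c: "c1 > 0" "c2 > 0"
    and L1: "((\<lambda>x. (ell p b1 b2 x - ell p b1 b2 x1) / (x - x1) ^ 2) \<longlongrightarrow> - c1) (at x1)"
    and L2: "((\<lambda>x. (ell p b1 b2 x - ell p b1 b2 x2) / (x - x2) ^ 2) \<longlongrightarrow> - c2) (at x2)"
  defines "g1 \<equiv> 1 / sqrt (x1 * (1 - x1) * c1)" and "g2 \<equiv> 1 / sqrt (x2 * (1 - x2) * c2)"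
  shows "(\<lambda>n. d2psi p n b1 b2 / real n) \<longlonglongrightarrow> (x1 - x2)\<^sup>2 * (g1 * g2 / (g1 + g2)\<^sup>2)"
proof -
  define M where "M = ell p b1 b2 x1"
  have xm: "x1 \<in> maximizers p b1 b2" "x2 \<in> maximizers p b1 b2" using max by auto
  have M2: "ell p b1 b2 x2 = M"
    using xm unfolding mem_maximizers[OF p] M_def by (metis antisym)
  note xi = maximizer_interior[OF p xm(1)] maximizer_interior[OF p xm(2)]
  \<comment> \<open>\<open>K * g1\<close> and \<open>K * g2\<close> are the limiting masses of the
    peaks: the Gaussian integral \<open>Gamma (1/2) / sqrt c\<close> over the Stirling factor
    \<open>stirling_const * sqrt (x * (1 - x))\<close>.\<close>
  define K where "K = Gamma (1/2) / stirling_const"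
  have K: "K > 0" using stirling_const(1) by (simp add: K_def Gamma_real_pos)
  have g: "g1 > 0" "g2 > 0" using xi c by (simp_all add: g1_def g2_def)
  define N where "N n = norm_const 2 n M" for n
  define E where "E \<delta> a j n = (\<Sum>k | k \<le> n \<and> \<bar>real k / real n - a\<bar> < \<delta>.
      wt p n b1 b2 k * ((real k - real n * a) / scale 2 n) ^ j) / N n" for \<delta> a j n
  have lap: "\<forall>\<^sub>F \<delta> in at_right 0. \<forall>j\<le>2. E \<delta> a j \<longlonglongrightarrow> power_exp_integral 2 c j / (stirling_const * sqrt (a * (1 - a)))"
    if "0 < a" "a < 1" "c > 0" "ell p b1 b2 a = M"
      "((\<lambda>x. (ell p b1 b2 x - ell p b1 b2 a) / (x - a) ^ 2) \<longlongrightarrow> - c) (at a)" for a c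
    using local_laplace[OF that(1,2) _ _ that(3,5)] that(4) unfolding E_def N_def norm_const_def by simp
  \<comment> \<open>Half the distance keeps the windows around the two maximizers disjoint.\<close>
  have "\<forall>\<^sub>F \<delta> in at_right 0. \<delta> < \<bar>x1 - x2\<bar> / 2"
    using max(2) by (auto simp: eventually_at_right_field intro!: exI[of _ "\<bar>x1 - x2\<bar> / 2"])
  from eventually_happens[OF eventually_conj[OF this eventually_conj[OF eventually_at_right_less[of 0]
      eventually_conj[OF lap[OF xi(1,2) c(1) _ L1] lap[OF xi(3,4) c(2) M2 L2]]]]]
  obtain \<delta> where \<delta>: "\<delta> < \<bar>x1 - x2\<bar> / 2" "\<delta> > 0"
    and E1: "\<And>j. j \<le> 2 \<Longrightarrow> E \<delta> x1 j \<longlonglongrightarrow> power_exp_integral 2 c1 j / (stirling_const * sqrt (x1 * (1 - x1)))"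
    and E2: "\<And>j. j \<le> 2 \<Longrightarrow> E \<delta> x2 j \<longlonglongrightarrow> power_exp_integral 2 c2 j / (stirling_const * sqrt (x2 * (1 - x2)))"
    by (auto simp: M_def)
  have E10: "E \<delta> x1 0 \<longlonglongrightarrow> K * g1" and E20: "E \<delta> x2 0 \<longlonglongrightarrow> K * g2"
    using E1[of 0] E2[of 0] c by (simp_all add: power_exp_integral_2_0 K_def g1_def g2_def real_sqrt_mult mult_ac)
  have E11: "E \<delta> x1 1 \<longlonglongrightarrow> 0" and E21: "E \<delta> x2 1 \<longlonglongrightarrow> 0"
    using E1[of 1] E2[of 1] power_exp_integral_1[OF c(1), of 2] power_exp_integral_1[OF c(2), of 2] by simp_all
  note E12 = E1[OF order_refl] and E22 = E2[OF order_refl]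
  define \<epsilon> where "\<epsilon> n = scale 2 n / real n" for n
  have \<epsilon>: "\<epsilon> \<longlonglongrightarrow> 0" unfolding \<epsilon>_def scale_2 by real_asymp
  have \<epsilon>_eq: "real k / real n - a = \<epsilon> n * ((real k - real n * a) / scale 2 n)" if "n > 0" for n k a
    using that scale_ge_1[OF that, of 2] by (simp add: \<epsilon>_def field_simps)
  define T where "T j n = (\<Sum>k | k \<le> n \<and> (\<forall>x\<in>maximizers p b1 b2. \<bar>real k / real n - x\<bar> \<ge> \<delta>).
      wt p n b1 b2 k * (real k / real n - x1) ^ j) / N n" for j n
  have T: "T j \<longlonglongrightarrow> 0" for j
    unfolding T_def N_def M_def
  proof (rule tail_negligible[OF p _ \<delta>(2) xm(1)])
    fix n k :: nat assume n: "n > 0" "k \<le> n"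
    have "0 \<le> real k / real n" "real k / real n \<le> 1" using n by auto
    then have "\<bar>real k / real n - x1\<bar> \<le> 1" using xi by linarith
    then have "\<bar>real k / real n - x1\<bar> ^ j \<le> 1" by (simp add: power_le_one)
    moreover have "1 \<le> real n ^ 2" using n by simp
    ultimately show "\<bar>(real k / real n - x1) ^ j\<bar> \<le> real n ^ 2" by (simp add: power_abs)
  qed simp
  \<comment> \<open>With the centre at \<open>x1\<close>, the first peak enters the orders 1 and 2
    only through powers of \<epsilon>, which vanish in the limit.\<close>
  define S where "S j n = (\<Sum>k\<le>n. wt p n b1 b2 k * (real k / real n - x1) ^ j) / N n" for j n
  define F where "F a j n = (\<Sum>k | k \<le> n \<and> \<bar>real k / real n - a\<bar> < \<delta>. wt p n b1 b2 k * (real k / real n - x1) ^ j) / N n" for a j n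
  have S_split: "S j n = F x1 j n + F x2 j n + T j n" for j n
  proof -
    let ?A = "\<lambda>a. {k. k \<le> n \<and> \<bar>real k / real n - a\<bar> < \<delta>}"
    let ?B = "{k. k \<le> n \<and> (\<forall>x\<in>maximizers p b1 b2. \<bar>real k / real n - x\<bar> \<ge> \<delta>)}"
    have "{..n} = (?A x1 \<union> ?A x2) \<union> ?B" by (auto simp: max)
    moreover have "(?A x1 \<union> ?A x2) \<inter> ?B = {}" by (auto simp: max)
    moreover have "?A x1 \<inter> ?A x2 = {}" using \<delta>(1) by (auto simp: abs_if split: if_splits)
    ultimately have "(\<Sum>k\<le>n. w k) = (\<Sum>k\<in>?A x1. w k) + (\<Sum>k\<in>?A x2. w k) + (\<Sum>k\<in>?B. w k)" for w :: "nat \<Rightarrow> real"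
      by (simp add: sum.union_disjoint)
    then show ?thesis by (simp add: S_def F_def T_def add_divide_distrib)
  qed
  have F1: "F x1 j n = \<epsilon> n ^ j * E \<delta> x1 j n" if "n > 0" for j n
  proof -
    have "(real k / real n - x1) ^ j = \<epsilon> n ^ j * ((real k - real n * x1) / scale 2 n) ^ j" for k
      by (subst \<epsilon>_eq[OF that]) (rule power_mult_distrib)
    then show ?thesis unfolding F_def E_def by (simp add: sum_distrib_left mult_ac)
  qed
  \<comment> \<open>Binomial expansion around \<open>x2\<close>: in the limit only the displacement
    \<open>x2 - x1\<close> remains.\<close>
  have F2: "F x2 1 n = \<epsilon> n * E \<delta> x2 1 n + (x2 - x1) * E \<delta> x2 0 n"
    "F x2 2 n = (\<epsilon> n)\<^sup>2 * E \<delta> x2 2 n + 2 * (x2 - x1) * \<epsilon> n * E \<delta> x2 1 n + (x2 - x1)\<^sup>2 * E \<delta> x2 0 n"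
    if n: "n > 0" for n
  proof -
    have e: "real k / real n - x1 = \<epsilon> n * ((real k - real n * x2) / scale 2 n) + (x2 - x1)" for k
      using \<epsilon>_eq[OF n, of k x2] by linarith
    have sq: "w * (a * t + b)\<^sup>2 = a\<^sup>2 * (w * t\<^sup>2) + 2 * b * a * (w * t ^ 1) + b\<^sup>2 * (w * t ^ 0)" for w a b t :: real
      by (simp add: power2_eq_square algebra_simps)
    show "F x2 1 n = \<epsilon> n * E \<delta> x2 1 n + (x2 - x1) * E \<delta> x2 0 n"
      unfolding F_def E_def e
      by (simp add: add_divide_distrib[symmetric] sum_distrib_left sum.distrib[symmetric] distrib_left mult_ac)
    show "F x2 2 n = (\<epsilon> n)\<^sup>2 * E \<delta> x2 2 n + 2 * (x2 - x1) * \<epsilon> n * E \<delta> x2 1 n + (x2 - x1)\<^sup>2 * E \<delta> x2 0 n"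
      unfolding F_def E_def e times_divide_eq_right add_divide_distrib[symmetric] sum_distrib_left sum.distrib[symmetric]
      by (intro arg_cong2[of _ _ _ _ "(/)"] sum.cong refl)
         (simp only: times_divide_eq_right[symmetric] sq)
  qed
  have ev: "\<forall>\<^sub>F n in sequentially. n > (0::nat)" by (rule eventually_gt_at_top)
  have S0: "S 0 \<longlonglongrightarrow> K * (g1 + g2)"
  proof -
    have "(\<lambda>n. E \<delta> x1 0 n + E \<delta> x2 0 n + T 0 n) \<longlonglongrightarrow> K * g1 + K * g2 + 0"
      by (intro tendsto_intros E10 E20 T)
    then show ?thesis
      unfolding S_split[abs_def] by (simp add: F_def E_def distrib_left)
  qed
  have S1: "S 1 \<longlonglongrightarrow> (x2 - x1) * (K * g2)"
  proof -
    have "(\<lambda>n. \<epsilon> n ^ 1 * E \<delta> x1 1 n + (\<epsilon> n * E \<delta> x2 1 n + (x2 - x1) * E \<delta> x2 0 n) + T 1 n)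
        \<longlonglongrightarrow> 0 ^ 1 * 0 + (0 * 0 + (x2 - x1) * (K * g2)) + 0"
      by (intro tendsto_intros E11 E20 E21 T \<epsilon>)
    then show ?thesis
      by (simp, elim Lim_transform_eventually, intro eventually_mono[OF ev]) (simp add: S_split F1 F2[unfolded One_nat_def])
  qed
  have S2: "S 2 \<longlonglongrightarrow> (x2 - x1)\<^sup>2 * (K * g2)"
  proof -
    have "(\<lambda>n. \<epsilon> n ^ 2 * E \<delta> x1 2 n + ((\<epsilon> n)\<^sup>2 * E \<delta> x2 2 n + 2 * (x2 - x1) * \<epsilon> n * E \<delta> x2 1 n + (x2 - x1)\<^sup>2 * E \<delta> x2 0 n) + T 2 n)
        \<longlonglongrightarrow> 0 ^ 2 * (power_exp_integral 2 c1 2 / (stirling_const * sqrt (x1 * (1 - x1))))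
           + (0\<^sup>2 * (power_exp_integral 2 c2 2 / (stirling_const * sqrt (x2 * (1 - x2)))) + 2 * (x2 - x1) * 0 * 0 + (x2 - x1)\<^sup>2 * (K * g2)) + 0"
      by (intro tendsto_add tendsto_mult tendsto_const tendsto_power E12 E20 E21 E22 T \<epsilon>)
    then show ?thesis
      by (simp, elim Lim_transform_eventually, intro eventually_mono[OF ev]) (simp add: S_split F1 F2[unfolded One_nat_def])
  qed
  have nz: "K * (g1 + g2) \<noteq> 0" using K g by simp
  have "(\<lambda>n. S 2 n / S 0 n - (S 1 n / S 0 n)\<^sup>2)
     \<longlonglongrightarrow> (x2 - x1)\<^sup>2 * (K * g2) / (K * (g1 + g2)) - ((x2 - x1) * (K * g2) / (K * (g1 + g2)))\<^sup>2"
    by (rule tendsto_diff[OF tendsto_divide[OF S2 S0 nz] tendsto_power[OF tendsto_divide[OF S1 S0 nz]]])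
  also have "(x2 - x1)\<^sup>2 * (K * g2) / (K * (g1 + g2)) - ((x2 - x1) * (K * g2) / (K * (g1 + g2)))\<^sup>2
      = (x1 - x2)\<^sup>2 * (g1 * g2 / (g1 + g2)\<^sup>2)"
  proof -
    have "d\<^sup>2 * (K * g2) / (K * (g1 + g2)) - (d * (K * g2) / (K * (g1 + g2)))\<^sup>2 = d\<^sup>2 * (g1 * g2 / (g1 + g2)\<^sup>2)" for d
      using K g by (simp add: divide_simps) (simp add: power2_eq_square algebra_simps)
    from this[of "x2 - x1"] show ?thesis by (simp only: power2_commute[of x2 x1])
  qed
  finally show ?thesis
  proof (elim Lim_transform_eventually, intro eventually_mono[OF ev])
    fix n :: nat assume n: "n > 0"
    have mom: "S j n = moment p n b1 b2 (real n * x1) j / real n ^ j / N n" for j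
    proof -
      have "real k / real n - x1 = (real k - real n * x1) / real n" for k
        using n by (simp add: field_simps)
      then show ?thesis
        by (simp add: S_def moment_def power_divide sum_divide_distrib)
    qed
    have *: "A / s ^ 2 / N / (w / s ^ 0 / N) - (B / s ^ 1 / N / (w / s ^ 0 / N))\<^sup>2 = (A / w - (B / w)\<^sup>2) / s / s"
      if "N \<noteq> 0" for A B s N w :: real
      using that by (simp add: power_divide diff_divide_distrib power2_eq_square mult_ac)
    have "N n \<noteq> 0" using norm_const_pos[OF n, of 2 M] by (simp add: N_def)
    show "S 2 n / S 0 n - (S 1 n / S 0 n)\<^sup>2 = d2psi p n b1 b2 / real n"
      unfolding mom d2psi_eq_variance[OF n, of p b1 b2 "real n * x1"] by (subst *[OF \<open>N n \<noteq> 0\<close>]) (simp add: moment_0)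
  qed
qed

section \<open>Order of contact of \<open>ell\<close> at a maximizer\<close>

lemma quotient_power_lhopital:
  fixes f f' :: "real \<Rightarrow> real"
  assumes der: "\<forall>\<^sub>F x in at a. (f has_real_derivative f' x) (at x)" and cont: "isCont f a"
    and lim: "((\<lambda>x. f' x / (x - a) ^ k) \<longlongrightarrow> L) (at a)"
  shows "((\<lambda>x. (f x - f a) / (x - a) ^ Suc k) \<longlongrightarrow> L / real (Suc k)) (at a)"
proof (rule lhopital)
  have ne: "\<forall>\<^sub>F x in at a. x \<noteq> a" by (simp add: eventually_at_filter)
  show "((\<lambda>x. f x - f a) \<longlongrightarrow> 0) (at a)"
    using cont by (simp add: isCont_def LIM_zero)
  show "((\<lambda>x. (x - a) ^ Suc k) \<longlongrightarrow> 0) (at a)"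
    by (auto intro!: tendsto_eq_intros)
  show "\<forall>\<^sub>F x in at a. (x - a) ^ Suc k \<noteq> 0" "\<forall>\<^sub>F x in at a. real (Suc k) * (x - a) ^ k \<noteq> 0"
    by (rule eventually_mono[OF ne], simp)+
  show "\<forall>\<^sub>F x in at a. ((\<lambda>x. f x - f a) has_real_derivative f' x) (at x)"
    using der by eventually_elim (auto intro!: derivative_eq_intros)
  show "\<forall>\<^sub>F x in at a. ((\<lambda>x. (x - a) ^ Suc k) has_real_derivative real (Suc k) * (x - a) ^ k) (at x)"
    by (intro always_eventually allI) (auto intro!: derivative_eq_intros simp del: power_Suc)
  show "((\<lambda>x. f' x / (real (Suc k) * (x - a) ^ k)) \<longlongrightarrow> L / real (Suc k)) (at a)"
    using tendsto_divide[OF lim tendsto_const[of "real (Suc k)"]] by (simp add: mult.commute)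
qed

lemma eventually_interior:
  assumes "0 < a" "a < (1::real)"
  shows "\<forall>\<^sub>F x in at a. 0 < x \<and> x < 1"
  using eventually_at_in_open[of "{0<..<1}" a] assms by (auto elim!: eventually_mono)

lemma ell_quadratic:
  assumes p: "p \<ge> 2" and x: "x0 \<in> maximizers p b1 b2"
  shows "((\<lambda>x. (ell p b1 b2 x - ell p b1 b2 x0) / (x - x0) ^ 2) \<longlongrightarrow> ell_d2 p b2 x0 / 2) (at x0)"
proof -
  note xi = maximizer_interior[OF p x]
  have "((\<lambda>x. ell_d1 p b1 b2 x / (x - x0) ^ 1) \<longlongrightarrow> ell_d2 p b2 x0) (at x0)"
    using ell_d1_deriv[OF p xi, of b1 b2] maximizer_d1[OF p x] by (simp add: has_field_derivative_iff)
  from quotient_power_lhopital[OF _ _ this, of "ell p b1 b2"]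
  show ?thesis
    using eventually_mono[OF eventually_interior[OF xi] ell_deriv[OF p]] DERIV_isCont[OF ell_deriv[OF p xi]]
    by (simp add: numeral_2_eq_2)
qed

text \<open>At the critical point \<open>k * hump\<close> peaks at \<open>xc\<close> with value 1,
  so the second derivative of \<open>ell\<close> vanishes there to second order. Three uses of
  \<open>quotient_power_lhopital\<close>, for \<open>hump\<close>, \<open>ell_d1\<close> and
  \<open>ell\<close>, raise the order to four with denominators 2, 3 and 4, without any higher
  derivatives of \<open>ell\<close>.\<close>

lemma ell_quartic:
  assumes p: "p \<ge> 2"
  shows "((\<lambda>x. (ell p (\<beta>1c p) (\<beta>2c p) x - ell p (\<beta>1c p) (\<beta>2c p) (xc p)) / (x - xc p) ^ 4)
            \<longlongrightarrow> - (real p ^ 5 / (24 * (real p - 1)\<^sup>2))) (at (xc p))"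
proof -
  let ?x = "xc p" and ?b1 = "\<beta>1c p" and ?b2 = "\<beta>2c p"
  note xc = xc[OF p]
  define k where "k = ?b2 * real p * (real p - 1)"
  have int: "\<forall>\<^sub>F x in at ?x. 0 < x \<and> x < 1" by (rule eventually_interior[OF xc])
  have "((\<lambda>x. - real p * x ^ (p - 2)) \<longlongrightarrow> - real p * ?x ^ (p - 2)) (at ?x)"
    by (intro tendsto_intros)
  then have "((\<lambda>x. real p * x ^ (p - 2) * (?x - x) / (x - ?x) ^ 1) \<longlongrightarrow> - real p * ?x ^ (p - 2)) (at ?x)"
    by (rule Lim_transform_eventually) (auto simp: eventually_at_filter field_simps)
  from quotient_power_lhopital[OF _ _ this, of "hump p"]
  have hump: "((\<lambda>x. (hump p x - hump p ?x) / (x - ?x) ^ 2) \<longlongrightarrow> - real p * ?x ^ (p - 2) / 2) (at ?x)"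
    using hump_deriv[OF p] DERIV_isCont[OF hump_deriv[OF p]] by (simp add: numeral_2_eq_2)
  have "((\<lambda>x. k * ((hump p x - hump p ?x) / (x - ?x) ^ 2) / (x * (1 - x)))
      \<longlongrightarrow> k * (- real p * ?x ^ (p - 2) / 2) / (?x * (1 - ?x))) (at ?x)"
    using xc by (intro tendsto_intros hump) auto
  moreover have "\<forall>\<^sub>F x in at ?x. k * ((hump p x - hump p ?x) / (x - ?x) ^ 2) / (x * (1 - x)) = ell_d2 p ?b2 x / (x - ?x) ^ 2"
    using int
  proof eventually_elim
    case (elim x)
    have "k * hump p ?x = 1" using \<beta>2c_hump(2)[OF p] by (simp add: k_def)
    moreover have "ell_d2 p ?b2 x = (k * hump p x - 1) / (x * (1 - x))"
      using elim ell_d2_hump[OF p, of x ?b2] by (simp only: k_def)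
    moreover have "k * ((u - v) / w) / r = (k * u - k * v) / r / w" for u v w r :: real
      by (simp add: right_diff_distrib mult.commute)
    ultimately show ?case by simp
  qed
  ultimately have "((\<lambda>x. ell_d2 p ?b2 x / (x - ?x) ^ 2) \<longlongrightarrow> k * (- real p * ?x ^ (p - 2) / 2) / (?x * (1 - ?x))) (at ?x)"
    by (rule Lim_transform_eventually)
  moreover have "\<forall>\<^sub>F x in at ?x. (ell_d1 p ?b1 ?b2 has_real_derivative ell_d2 p ?b2 x) (at x)"
    using int by eventually_elim (auto intro: ell_d1_deriv[OF p])
  ultimately have "((\<lambda>x. (ell_d1 p ?b1 ?b2 x - ell_d1 p ?b1 ?b2 ?x) / (x - ?x) ^ Suc 2)
      \<longlongrightarrow> k * (- real p * ?x ^ (p - 2) / 2) / (?x * (1 - ?x)) / real (Suc 2)) (at ?x)"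
    by (intro quotient_power_lhopital DERIV_isCont[OF ell_d1_deriv[OF p xc]])
  then
  have "((\<lambda>x. ell_d1 p ?b1 ?b2 x / (x - ?x) ^ Suc 2) \<longlongrightarrow> k * (- real p * ?x ^ (p - 2) / 2) / (?x * (1 - ?x)) / real (Suc 2)) (at ?x)"
    by (simp only: ell_d1_xc[OF p] diff_self mult_zero_left add_0_left diff_zero)
  moreover have "\<forall>\<^sub>F x in at ?x. (ell p ?b1 ?b2 has_real_derivative ell_d1 p ?b1 ?b2 x) (at x)"
    using int by eventually_elim (auto intro: ell_deriv[OF p])
  ultimately have "((\<lambda>x. (ell p ?b1 ?b2 x - ell p ?b1 ?b2 ?x) / (x - ?x) ^ Suc (Suc 2))
      \<longlongrightarrow> k * (- real p * ?x ^ (p - 2) / 2) / (?x * (1 - ?x)) / real (Suc 2) / real (Suc (Suc 2))) (at ?x)"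
    by (intro quotient_power_lhopital DERIV_isCont[OF ell_deriv[OF p xc]])
  then have "((\<lambda>x. (ell p ?b1 ?b2 x - ell p ?b1 ?b2 ?x) / (x - ?x) ^ 4)
      \<longlongrightarrow> k * (- real p * ?x ^ (p - 2) / 2) / (?x * (1 - ?x)) / 3 / 4) (at ?x)"
    by (simp add: numeral_eq_Suc)
  also have "k * (- real p * ?x ^ (p - 2) / 2) / (?x * (1 - ?x)) / 3 / 4 = - (real p ^ 5 / (24 * (real p - 1)\<^sup>2))"
  proof -
    have "?x ^ (p - 1) = ?x * ?x ^ (p - 2)"
      using p by (metis Suc_diff_le diff_Suc_Suc numeral_2_eq_2 power_Suc One_nat_def)
    then have "k * (?x * ?x ^ (p - 2) * (1 - ?x)) = 1"
      using \<beta>2c_hump(2)[OF p] by (simp add: k_def hump_def[OF p])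
    \<comment> \<open>The peak condition eliminates \<beta>2c, and
      \<open>xc * (1 - xc) = (p - 1) / p^2\<close> then produces the fifth power of
      \<open>p\<close>.\<close>
    then have "k * ?x ^ (p - 2) = 1 / (?x * (1 - ?x))"
      using xc by (simp add: field_simps)
    moreover have "k * (- real p * ?x ^ (p - 2) / 2) / (?x * (1 - ?x)) / 3 / 4 = - real p / 24 * (k * ?x ^ (p - 2)) / (?x * (1 - ?x))"
      by simp
    ultimately have "k * (- real p * ?x ^ (p - 2) / 2) / (?x * (1 - ?x)) / 3 / 4 = - real p / 24 * (1 / (?x * (1 - ?x))) / (?x * (1 - ?x))"
      by simp
    also have "\<dots> = - (real p ^ 5 / (24 * (real p - 1)\<^sup>2))"
    proof -
      have aux: "- v / 24 * (1 / (u / v * (1 / v))) / (u / v * (1 / v)) = - (v ^ 5 / (24 * u\<^sup>2))" if "v > 0" for u v :: real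
        using that by (simp add: power2_eq_square numeral_eq_Suc)
      then show ?thesis using p unfolding one_minus_xc[OF p] unfolding xc_def[OF p] by (intro aux) simp
    qed
    finally show ?thesis .
  qed
  finally show ?thesis .
qed

section \<open>The limiting free energy\<close>

text \<open>Above, \<open>W\<close> has \<open>n + 1\<close> terms of size at most
  \<open>exp (n * M)\<close>; below, the single term at \<open>k = floor (n * x)\<close> suffices,
  its prefactor being at least of order \<open>1 / sqrt n\<close>. Both corrections vanish after
  \<open>ln\<close> and division by \<open>n\<close>.\<close>

lemma psi_tendsto_maximum:
  assumes p: "p \<ge> 2" and x: "x \<in> maximizers p b1 b2"
  shows "(\<lambda>n. psi p n b1 b2) \<longlonglongrightarrow> ell p b1 b2 x"
proof -
  let ?M = "ell p b1 b2 x"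
  note xi = maximizer_interior[OF p x]
  obtain B where B: "B > 0" "\<And>n. stirling_ratio n \<le> B" "\<And>n. 1 / stirling_ratio n \<le> B"
    using stirling_ratio_bounded by metis
  define k where "k n = nat \<lfloor>real n * x\<rfloor>" for n
  define y where "y n = real (k n) / real n" for n
  have k: "real n * x - 1 < real (k n)" "real (k n) \<le> real n * x" for n
    using xi by (simp_all add: k_def)
  have "(\<lambda>n. (real n * x - 1) / real n) \<longlonglongrightarrow> x" "(\<lambda>n. real n * x / real n) \<longlonglongrightarrow> x"
    by real_asymp+
  moreover have "(real n * x - 1) / real n \<le> y n" "y n \<le> real n * x / real n" for n
    unfolding y_def using k(1)[of n] k(2)[of n] by (intro divide_right_mono; simp)+
  ultimately have y_lim: "y \<longlonglongrightarrow> x"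
    by (intro tendsto_sandwich[of "\<lambda>n. (real n * x - 1) / real n" y _ "\<lambda>n. real n * x / real n"] always_eventually allI)
  have ell_lim: "(\<lambda>n. ell p b1 b2 (y n)) \<longlonglongrightarrow> ?M"
    using DERIV_isCont[OF ell_deriv[OF p xi]] y_lim by (rule isCont_tendsto_compose)
  show ?thesis
  proof (rule tendsto_sandwich)
    have "(\<lambda>n. (ln (1 / B ^ 3) - ln (real n) / 2) / real n) \<longlonglongrightarrow> 0" by real_asymp
    from tendsto_add[OF ell_lim this]
    show "(\<lambda>n. ell p b1 b2 (y n) + (ln (1 / B ^ 3) - ln (real n) / 2) / real n) \<longlonglongrightarrow> ?M" by simp
    have "(\<lambda>n. ln (real n + 1) / real n) \<longlonglongrightarrow> 0" by real_asymp
    from tendsto_add[OF tendsto_const[of ?M] this]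
    show "(\<lambda>n. ?M + ln (real n + 1) / real n) \<longlonglongrightarrow> ?M" by simp
    show "\<forall>\<^sub>F n in sequentially. psi p n b1 b2 \<le> ?M + ln (real n + 1) / real n"
    proof (rule eventually_mono[OF eventually_gt_at_top[of 0]])
      fix n :: nat assume n: "n > 0"
      have "W p n b1 b2 \<le> (\<Sum>k\<le>n. exp (real n * ?M))"
        unfolding W_def
      proof (rule sum_mono)
        fix k assume "k \<in> {..n}"
        then have "ell p b1 b2 (real k / real n) \<le> ?M"
          using x n by (auto simp: mem_maximizers[OF p])
        then have "exp (real n * ell p b1 b2 (real k / real n)) \<le> exp (real n * ?M)"
          by (simp add: mult_left_mono)
        then show "wt p n b1 b2 k \<le> exp (real n * ?M)"
          using wt_le_exp[of k n p b1 b2] \<open>k \<in> {..n}\<close> n by (auto intro: order_trans)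
      qed
      also have "\<dots> = (real n + 1) * exp (real n * ?M)" by (simp add: add_ac)
      finally have "ln (W p n b1 b2) \<le> ln ((real n + 1) * exp (real n * ?M))"
        using W_pos[of p n b1 b2] by (subst ln_le_cancel_iff) auto
      also have "\<dots> = ln (real n + 1) + real n * ?M"
        by (subst ln_mult) auto
      finally show "psi p n b1 b2 \<le> ?M + ln (real n + 1) / real n"
        using n by (simp add: psi_eq_ln_W field_simps)
    qed
    have "\<forall>\<^sub>F n in sequentially. y n > 0" "\<forall>\<^sub>F n in sequentially. y n < 1"
      using order_tendstoD[OF y_lim] xi by auto
    then show "\<forall>\<^sub>F n in sequentially. ell p b1 b2 (y n) + (ln (1 / B ^ 3) - ln (real n) / 2) / real n \<le> psi p n b1 b2"
      using eventually_gt_at_top[of 0]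
    proof eventually_elim
      case (elim n)
      then have n: "n > 0" and kn: "0 < k n" "k n < n" by (auto simp: y_def field_simps)
      have pos: "stirling_ratio n > 0" "stirling_ratio (k n) > 0" "stirling_ratio (n - k n) > 0"
        using kn by (auto intro!: stirling_ratio_pos)
      have "1 / stirling_ratio n * (stirling_ratio (k n) * stirling_ratio (n - k n)) \<le> B * (B * B)"
        using pos B by (intro mult_mono mult_nonneg_nonneg) (auto simp: less_imp_le)
      then have "1 / B ^ 3 \<le> stirling_ratio n / (stirling_ratio (k n) * stirling_ratio (n - k n))"
        using pos B(1) by (simp add: field_simps power3_eq_cube)
      moreover have "1 / sqrt (real n) \<le> 1 / sqrt (real n * y n * (1 - y n))"
      proof -
        have "y n * (1 - y n) \<le> 1 * 1" using elim by (intro mult_mono) auto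
        then have "real n * (y n * (1 - y n)) \<le> real n * 1" by (intro mult_left_mono) auto
        then have "sqrt (real n * y n * (1 - y n)) \<le> sqrt (real n)" by (simp add: mult.assoc)
        then show ?thesis using elim by (intro divide_left_mono) auto
      qed
      ultimately have "(1 / B ^ 3) * (1 / sqrt (real n)) \<le> stirling_ratio n / (stirling_ratio (k n) * stirling_ratio (n - k n))
          * (1 / sqrt (real n * y n * (1 - y n)))"
        using B(1) pos by (intro mult_mono) auto
      moreover have "wt p n b1 b2 (k n) = stirling_ratio n / (stirling_ratio (k n) * stirling_ratio (n - k n))
          * (1 / sqrt (real n * y n * (1 - y n))) * exp (real n * ell p b1 b2 (y n))"
        using wt_eq_stirling[OF kn, of p b1 b2] by (simp only: y_def times_divide_eq_right mult_1_right)
      ultimately have "(1 / B ^ 3) * (1 / sqrt (real n)) * exp (real n * ell p b1 b2 (y n)) \<le> wt p n b1 b2 (k n)"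
        by (simp only: mult_right_mono exp_ge_zero)
      also have "\<dots> \<le> W p n b1 b2"
        unfolding W_def using kn wt_nonneg by (intro member_le_sum) auto
      finally have "ln ((1 / B ^ 3) * (1 / sqrt (real n)) * exp (real n * ell p b1 b2 (y n))) \<le> ln (W p n b1 b2)"
        using B(1) n W_pos[of p n b1 b2] by (subst ln_le_cancel_iff) auto
      moreover have "ln ((1 / B ^ 3) * (1 / sqrt (real n)) * exp (real n * ell p b1 b2 (y n)))
          = ln (1 / B ^ 3) - ln (real n) / 2 + real n * ell p b1 b2 (y n)"
        using B(1) n by (subst ln_mult; simp add: ln_mult ln_div ln_sqrt)
      ultimately have "ln (1 / B ^ 3) - ln (real n) / 2 + real n * ell p b1 b2 (y n) \<le> ln (W p n b1 b2)"
        by linarith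
      then have "(ln (1 / B ^ 3) - ln (real n) / 2 + real n * ell p b1 b2 (y n)) / real n \<le> psi p n b1 b2"
        unfolding psi_eq_ln_W[OF n] by (rule divide_right_mono) simp
      then show ?case
        using n by (simp add: add_divide_distrib)
    qed
  qed
qed

text \<open>A sequence of distant maximizers would, by compactness, accumulate at a second maximizer
  for \<open>b1\<close>. Uniqueness is assumed at \<open>b1\<close> alone, not at nearby
  parameters.\<close>

lemma maximizers_eventually_near:
  assumes p: "p \<ge> 2" and max: "maximizers p b1 b2 = {x0}" and e: "e > 0"
  shows "\<forall>\<^sub>F b in nhds b1. \<forall>x\<in>maximizers p b b2. \<bar>x - x0\<bar> < e"
proof (rule ccontr)
  assume not: "\<not> ?thesis"
  have "\<exists>b. \<bar>b - b1\<bar> < 1 / real (Suc n) \<and> (\<exists>x\<in>maximizers p b b2. \<bar>x - x0\<bar> \<ge> e)" for n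
    using not unfolding eventually_nhds_metric dist_real_def
    by (metis not_less zero_less_divide_1_iff of_nat_0_less_iff zero_less_Suc)
  then obtain b x where b: "\<And>n. \<bar>b n - b1\<bar> < 1 / real (Suc n)"
    and x: "\<And>n. x n \<in> maximizers p (b n) b2" "\<And>n. \<bar>x n - x0\<bar> \<ge> e" by metis
  have "(\<lambda>n. b n - b1) \<longlonglongrightarrow> 0"
  proof (rule Lim_null_comparison)
    show "(\<lambda>n. 1 / real (Suc n)) \<longlonglongrightarrow> 0" by real_asymp
  qed (use b in \<open>auto intro!: always_eventually less_imp_le\<close>)
  then have "b \<longlonglongrightarrow> b1" by (rule LIM_zero_cancel)
  then obtain z r where z: "z \<in> maximizers p b1 b2" "(x \<circ> r) \<longlonglongrightarrow> z"
    by (rule maximizer_limit_subseq[OF p, where b = "\<lambda>_. b2", OF x(1) tendsto_const])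
  have "(\<lambda>n. \<bar>(x \<circ> r) n - x0\<bar>) \<longlonglongrightarrow> \<bar>z - x0\<bar>" by (intro tendsto_intros z)
  then have "e \<le> \<bar>z - x0\<bar>" using x(2) by (intro LIMSEQ_le_const) auto
  then show False using z(1) max e by simp
qed

text \<open>The envelope argument: the limit free energy is the supremum of the affine functions
  \<open>b \<mapsto> ell p b \<beta>2 x\<close>, so its derivative is the maximizer, which inverts a function with
  derivative \<open>- ell''\<close>.\<close>

lemma limit_psi_second_derivative:
  assumes p: "p \<ge> 2" and max: "maximizers p b1 b2 = {x0}" and neg: "ell_d2 p b2 x0 < 0"
  shows "has_second_derivative (\<lambda>b. lim (\<lambda>n. psi p n b b2)) (1 / \<bar>ell_d2 p b2 x0\<bar>) b1"
proof -
  have x0m: "x0 \<in> maximizers p b1 b2" using max by simp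
  note x0 = maximizer_interior[OF p x0m]
  define L where "L b = lim (\<lambda>n. psi p n b b2)" for b
  \<comment> \<open>An arbitrary selection; near \<open>b1\<close> injectivity of \<open>g\<close>
    leaves no choice.\<close>
  define h where "h b = (SOME x. x \<in> maximizers p b b2)" for b
  have h: "h b \<in> maximizers p b b2" for b
    unfolding h_def using maximizers_nonempty[OF p] by (simp add: some_in_eq)
  have L: "L b = ell p b b2 (h b)" for b
    unfolding L_def by (rule limI[OF psi_tendsto_maximum[OF p h]])
  have env: "L b + (b' - b) * h b \<le> L b'" for b b'
  proof -
    have "L b + (b' - b) * h b = ell p b' b2 (h b)" by (simp add: L ell_def algebra_simps)
    also have "\<dots> \<le> L b'" using h[of b] h[of b'] by (auto simp: L mem_maximizers[OF p])
    finally show ?thesis .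
  qed
  \<comment> \<open>\<beta>1 enters \<open>ell_d1\<close> additively, so the first-order condition
    can be solved for it: \<open>g\<close> returns the parameter for which a given point is
    critical, hence \<open>g (h b) = b\<close> for every \<open>b\<close>.\<close>
  define g where "g x = b1 - ell_d1 p b1 b2 x" for x
  have g_h: "g (h b) = b" for b
    using maximizer_d1[OF p h[of b]] by (simp add: g_def ell_d1_def)
  have g_deriv: "(g has_real_derivative - ell_d2 p b2 x) (at x)" if "0 < x" "x < 1" for x
    unfolding g_def[abs_def] using that by (auto intro!: derivative_eq_intros ell_d1_deriv[OF p])
  have "isCont (ell_d2 p b2) x0"
    unfolding ell_d2_def[abs_def] using x0 by (intro continuous_intros) auto
  then have "\<forall>\<^sub>F x in at x0. ell_d2 p b2 x < 0"
    unfolding isCont_def using neg by (rule order_tendstoD)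
  then obtain e where e: "e > 0" "\<And>x. \<bar>x - x0\<bar> < e \<Longrightarrow> ell_d2 p b2 x < 0" "\<And>x. \<bar>x - x0\<bar> < e \<Longrightarrow> 0 < x \<and> x < 1"
  proof -
    have "\<forall>\<^sub>F x in nhds x0. ell_d2 p b2 x < 0 \<and> 0 < x \<and> x < 1"
      using eventually_conj[OF \<open>\<forall>\<^sub>F x in at x0. _\<close> eventually_interior[OF x0]] neg x0
      by (auto simp: eventually_at_filter elim: eventually_mono)
    then show ?thesis using that by (auto simp: eventually_nhds_metric dist_real_def)
  qed
  have g_mono: "g u < g v" if "\<bar>u - x0\<bar> < e" "\<bar>v - x0\<bar> < e" "u < v" for u v
  proof -
    have "ell_d1 p b1 b2 v < ell_d1 p b1 b2 u"
    proof (rule d1_strict_antimono[OF p])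
      fix y assume "u < y" "y < v"
      then have "\<bar>y - x0\<bar> < e" using that by auto
      then show "ell_d2 p b2 y < 0" by (rule e(2))
    qed (use that e(3) in auto)
    then show ?thesis by (simp add: g_def)
  qed
  have g_inj: "u = v" if "\<bar>u - x0\<bar> < e" "\<bar>v - x0\<bar> < e" "g u = g v" for u v
    using g_mono[OF that(1,2)] g_mono[OF that(2,1)] that(3) by (cases u v rule: linorder_cases) auto
  obtain d where d: "d > 0" "\<And>b. \<bar>b - b1\<bar> < d \<Longrightarrow> \<bar>h b - x0\<bar> < e"
    using maximizers_eventually_near[OF p max e(1)] h
    by (auto simp: eventually_nhds_metric dist_real_def)
  have h_cont: "isCont h b" if b: "\<bar>b - b1\<bar> < d" for b
  proof -
    have he: "\<bar>h b - x0\<bar> < e" using d(2)[OF b] .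
    have "isCont g (h b)" using he e(3) by (intro DERIV_isCont[OF g_deriv]) auto
    then have "(g \<longlongrightarrow> g (h b)) (nhds (h b))" unfolding isCont_def tendsto_at_iff_tendsto_nhds .
    then have "(g \<longlongrightarrow> b) (nhds (h b))" by (simp only: g_h)
    then have "\<forall>\<^sub>F z in nhds (h b). dist (g z) b < d - \<bar>b - b1\<bar>"
      using b by (intro tendstoD) auto
    moreover have "\<forall>\<^sub>F z in nhds (h b). dist z (h b) < e - \<bar>h b - x0\<bar>"
      using he by (auto simp: eventually_nhds_metric intro!: exI[of _ "e - \<bar>h b - x0\<bar>"])
    ultimately have "\<forall>\<^sub>F z in nhds (h b). \<bar>g z - b1\<bar> < d \<and> \<bar>z - x0\<bar> < e"
      by eventually_elim (auto simp: dist_real_def)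
    then obtain r where r: "r > 0" "\<And>z. \<bar>z - h b\<bar> < r \<Longrightarrow> \<bar>g z - b1\<bar> < d \<and> \<bar>z - x0\<bar> < e"
      by (auto simp: eventually_nhds_metric dist_real_def)
    \<comment> \<open>The inverse function theorem wants \<open>h (g z) = z\<close> on a
      neighbourhood. Both sides have the same image under \<open>g\<close> and lie where
      \<open>g\<close> is injective.\<close>
    have "isCont h (g (h b))"
    proof (rule isCont_inverse_function[of "r / 2" "h b" h g])
      fix z assume "\<bar>z - h b\<bar> \<le> r / 2"
      then have z: "\<bar>g z - b1\<bar> < d" "\<bar>z - x0\<bar> < e" using r(2)[of z] r(1) by auto
      show "h (g z) = z" by (rule g_inj[OF d(2)[OF z(1)] z(2)]) (rule g_h)
      show "isCont g z" using z e(3) by (intro DERIV_isCont[OF g_deriv]) auto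
    qed (use r in auto)
    then show ?thesis by (simp add: g_h)
  qed
  have L_deriv: "(L has_real_derivative h b) (at b)" if b: "\<bar>b - b1\<bar> < d" for b
    unfolding has_field_derivative_iff
  proof (rule tendsto_sandwich)
    have hb: "(h \<longlongrightarrow> h b) (at b)" using h_cont[OF b] by (simp add: isCont_def)
    show "((\<lambda>b'. min (h b) (h b')) \<longlongrightarrow> h b) (at b)" "((\<lambda>b'. max (h b) (h b')) \<longlongrightarrow> h b) (at b)"
      using tendsto_min[OF tendsto_const hb, of "h b"] tendsto_max[OF tendsto_const hb, of "h b"] by simp_all
    \<comment> \<open>The supporting lines at \<open>b\<close> and at \<open>b'\<close> trap the
      difference quotient between their slopes, so continuity of \<open>h\<close> gives the
      derivative of \<open>L\<close>.\<close>
    have "min (h b) (h b') \<le> (L b' - L b) / (b' - b) \<and> (L b' - L b) / (b' - b) \<le> max (h b) (h b')" if "b' \<noteq> b" for b'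
    proof (cases "b < b'")
      case True
      then have "h b \<le> (L b' - L b) / (b' - b)" "(L b' - L b) / (b' - b) \<le> h b'"
        using env[of b b'] env[of b' b] by (simp_all add: field_simps)
      then show ?thesis by (simp add: min_le_iff_disj le_max_iff_disj)
    next
      case False
      then have "b' < b" using that by simp
      then have "h b' \<le> (L b' - L b) / (b' - b)" "(L b' - L b) / (b' - b) \<le> h b"
        using env[of b b'] env[of b' b] by (simp_all add: field_simps)
      then show ?thesis by (simp add: min_le_iff_disj le_max_iff_disj)
    qed
    then show "\<forall>\<^sub>F b' in at b. min (h b) (h b') \<le> (L b' - L b) / (b' - b)"
      "\<forall>\<^sub>F b' in at b. (L b' - L b) / (b' - b) \<le> max (h b) (h b')"
      by (auto simp: eventually_at_filter)
  qed
  have "h b1 = x0" using h[of b1] max by simp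
  have "(h has_real_derivative inverse (- ell_d2 p b2 x0)) (at b1)"
  proof (rule DERIV_inverse_function[where f = g and a = "b1 - d" and b = "b1 + d"])
    show "(g has_real_derivative - ell_d2 p b2 x0) (at (h b1))"
      unfolding \<open>h b1 = x0\<close> by (rule g_deriv[OF x0])
    show "isCont h b1" using h_cont[of b1] d(1) by simp
  qed (use d neg g_h in auto)
  moreover have "inverse (- ell_d2 p b2 x0) = 1 / \<bar>ell_d2 p b2 x0\<bar>"
    using neg by (simp add: inverse_eq_divide)
  moreover have "\<forall>\<^sub>F b in nhds b1. (L has_real_derivative h b) (at b)"
    using L_deriv d(1) by (auto simp: eventually_nhds_metric dist_real_def)
  ultimately show ?thesis
    unfolding has_second_derivative_def L_def[abs_def] by auto
qed

section \<open>Evaluation of the limiting constants in the three regimes\<close>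

theorem theorem4:
  fixes p :: nat and \<beta>1 \<beta>2 :: real
  assumes "p \<ge> 2"
  shows
    "((\<beta>1, \<beta>2) \<notin> phase_curve p \<longrightarrow>
       (\<exists>x\<in>{0<..<1}. maximizers p \<beta>1 \<beta>2 = {x} \<and>
          (\<lambda>n. d2psi p n \<beta>1 \<beta>2) \<longlonglongrightarrow> 1 / \<bar>ell'' p \<beta>1 \<beta>2 x\<bar> \<and>
          (\<forall>\<^sub>F b in nhds \<beta>1. convergent (\<lambda>n. psi p n b \<beta>2)) \<and>
          has_second_derivative (\<lambda>b. lim (\<lambda>n. psi p n b \<beta>2)) (1 / \<bar>ell'' p \<beta>1 \<beta>2 x\<bar>) \<beta>1)) \<and>
     ((\<beta>1, \<beta>2) \<in> phase_curve p \<and> (\<beta>1, \<beta>2) \<noteq> (\<beta>1c p, \<beta>2c p) \<longrightarrow>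
       (\<exists>x1 x2. 0 < x1 \<and> x1 < (real p - 1) / real p \<and> (real p - 1) / real p < x2 \<and> x2 < 1 \<and>
          maximizers p \<beta>1 \<beta>2 = {x1, x2} \<and>
          (\<lambda>n. d2psi p n \<beta>1 \<beta>2 / real n) \<longlonglongrightarrow>
            (x1 - x2)\<^sup>2 * sqrt (x1 * (1 - x1) * \<bar>ell'' p \<beta>1 \<beta>2 x1\<bar>)
                       * sqrt (x2 * (1 - x2) * \<bar>ell'' p \<beta>1 \<beta>2 x2\<bar>)
            / (sqrt (x1 * (1 - x1) * \<bar>ell'' p \<beta>1 \<beta>2 x1\<bar>)
                + sqrt (x2 * (1 - x2) * \<bar>ell'' p \<beta>1 \<beta>2 x2\<bar>))\<^sup>2)) \<and>
     ((\<beta>1, \<beta>2) = (\<beta>1c p, \<beta>2c p) \<longrightarrow>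
       (\<lambda>n. d2psi p n \<beta>1 \<beta>2 / sqrt (real n)) \<longlonglongrightarrow>
         Gamma (3/4) / Gamma (1/4) * (2 * sqrt 6 * (real p - 1) / real p powr (5/2)))"
proof (intro conjI impI)
  note p = assms
  have ev: "\<forall>\<^sub>F n in sequentially. n > (0::nat)" by (rule eventually_gt_at_top)
  {
    assume off: "(\<beta>1, \<beta>2) \<notin> phase_curve p"
    then obtain x where x: "0 < x" "x < 1" "maximizers p \<beta>1 \<beta>2 = {x}"
      by (cases rule: maximizers_cases[OF p, of \<beta>1 \<beta>2]) (auto simp: phase_curve_iff[OF p])
    have neg: "ell_d2 p \<beta>2 x < 0"
      using off x(3) by (intro maximizer_nondegenerate[OF p, of x \<beta>1]) (auto simp: phase_curve_iff[OF p])
    have ell'': "ell'' p \<beta>1 \<beta>2 x = ell_d2 p \<beta>2 x" by (rule ell''_eq[OF p x(1,2)])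
    \<comment> \<open>The quadratic Taylor coefficient, hence the half; the ratio of integrals
      \<open>1 / (2 * c)\<close> then becomes \<open>1 / \<bar>ell''\<bar>\<close>.\<close>
    define c where "c = - ell_d2 p \<beta>2 x / 2"
    have c: "c > 0" using neg by (simp add: c_def)
    have "(\<lambda>n. d2psi p n \<beta>1 \<beta>2 * real n / (scale 2 n)\<^sup>2) \<longlonglongrightarrow> power_exp_integral 2 c 2 / power_exp_integral 2 c 0"
      using ell_quadratic[OF p, of x \<beta>1 \<beta>2] x(3) c by (intro d2psi_unique_maximizer[OF p x(3)]) (auto simp: c_def)
    also have "power_exp_integral 2 c 2 / power_exp_integral 2 c 0 = 1 / \<bar>ell'' p \<beta>1 \<beta>2 x\<bar>"
    proof -
      have G: "Gamma (3/2 :: real) = Gamma (1/2) / 2"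
        using Gamma_plus1[of "1/2 :: real"] by (force dest: nonpos_Ints_nonpos)
      have "Gamma (1/2 :: real) \<noteq> 0" using Gamma_real_pos[of "1/2"] by linarith
      moreover have "c powr (-3/2) = c powr (-1/2) / c"
        using c powr_diff[of c "-1/2" 1] by simp
      moreover have "c powr (-1/2) > 0" using c by simp
      ultimately have "power_exp_integral 2 c 2 / power_exp_integral 2 c 0 = 1 / (2 * c)"
        using c by (simp add: power_exp_integral_even G)
      then show ?thesis using neg by (simp add: ell'' c_def)
    qed
    finally have "(\<lambda>n. d2psi p n \<beta>1 \<beta>2) \<longlonglongrightarrow> 1 / \<bar>ell'' p \<beta>1 \<beta>2 x\<bar>"
      by (elim Lim_transform_eventually, intro eventually_mono[OF ev]) (simp add: scale_2)
    moreover have "convergent (\<lambda>n. psi p n b \<beta>2)" for b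
      using psi_tendsto_maximum[OF p] maximizers_nonempty[OF p, of b \<beta>2] by (auto intro: convergentI)
    ultimately show "\<exists>x\<in>{0<..<1}. maximizers p \<beta>1 \<beta>2 = {x} \<and>
          (\<lambda>n. d2psi p n \<beta>1 \<beta>2) \<longlonglongrightarrow> 1 / \<bar>ell'' p \<beta>1 \<beta>2 x\<bar> \<and>
          (\<forall>\<^sub>F b in nhds \<beta>1. convergent (\<lambda>n. psi p n b \<beta>2)) \<and>
          has_second_derivative (\<lambda>b. lim (\<lambda>n. psi p n b \<beta>2)) (1 / \<bar>ell'' p \<beta>1 \<beta>2 x\<bar>) \<beta>1"
      using x limit_psi_second_derivative[OF p x(3) neg] by (intro bexI[of _ x]) (auto simp: ell'')
  }
  {
    assume on: "(\<beta>1, \<beta>2) \<in> phase_curve p \<and> (\<beta>1, \<beta>2) \<noteq> (\<beta>1c p, \<beta>2c p)"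
    then obtain x1 x2 where x: "x1 < xc p" "xc p < x2" "maximizers p \<beta>1 \<beta>2 = {x1, x2}"
      unfolding phase_curve_iff[OF p] maximizers_card_2_iff[OF p] by blast
    have xm: "x1 \<in> maximizers p \<beta>1 \<beta>2" "x2 \<in> maximizers p \<beta>1 \<beta>2" using x by auto
    note xi = maximizer_interior[OF p xm(1)] maximizer_interior[OF p xm(2)]
    have neg: "ell_d2 p \<beta>2 x1 < 0" "ell_d2 p \<beta>2 x2 < 0"
      using on xm by (auto intro!: maximizer_nondegenerate[OF p])
    have ell'': "ell'' p \<beta>1 \<beta>2 x1 = ell_d2 p \<beta>2 x1" "ell'' p \<beta>1 \<beta>2 x2 = ell_d2 p \<beta>2 x2"
      by (rule ell''_eq[OF p xi(1,2)], rule ell''_eq[OF p xi(3,4)])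
    define s where "s y = sqrt (y * (1 - y) * \<bar>ell_d2 p \<beta>2 y\<bar>)" for y
    have s: "s x1 > 0" "s x2 > 0"
      unfolding s_def using xi neg by (intro real_sqrt_gt_zero mult_pos_pos; simp)+
    \<comment> \<open>The masses use the Taylor coefficient, the claimed formula the second
      derivative. They differ by a factor \<open>sqrt 2\<close>, which cancels because the weight
      expression is homogeneous of degree 0.\<close>
    define g where "g y = 1 / sqrt (y * (1 - y) * (- ell_d2 p \<beta>2 y / 2))" for y
    have gs: "g y = sqrt 2 / s y" if "ell_d2 p \<beta>2 y < 0" for y
    proof -
      have "y * (1 - y) * (- ell_d2 p \<beta>2 y / 2) = y * (1 - y) * \<bar>ell_d2 p \<beta>2 y\<bar> / 2" using that by simp
      then show ?thesis by (simp only: g_def s_def real_sqrt_divide) simp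
    qed
    have "(\<lambda>n. d2psi p n \<beta>1 \<beta>2 / real n) \<longlonglongrightarrow> (x1 - x2)\<^sup>2 * (g x1 * g x2 / (g x1 + g x2)\<^sup>2)"
      unfolding g_def
      by (rule d2psi_two_maximizers[OF p x(3)])
         (use x neg ell_quadratic[OF p xm(1)] ell_quadratic[OF p xm(2)] in auto)
    also have "(x1 - x2)\<^sup>2 * (g x1 * g x2 / (g x1 + g x2)\<^sup>2) = (x1 - x2)\<^sup>2 * s x1 * s x2 / (s x1 + s x2)\<^sup>2"
    proof -
      have "(r / a) * (r / b) / (r / a + r / b)\<^sup>2 = a * b / (a + b)\<^sup>2" if "a > 0" "b > 0" "r > 0" for a b r :: real
      proof -
        have "r / a + r / b = r * (a + b) / (a * b)" using that by (simp add: field_simps)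
        then show ?thesis using that by (simp add: power_divide power_mult_distrib power2_eq_square)
      qed
      from this[OF s, of "sqrt 2"] show ?thesis by (simp add: gs neg mult.assoc)
    qed
    finally show "\<exists>x1 x2. 0 < x1 \<and> x1 < (real p - 1) / real p \<and> (real p - 1) / real p < x2 \<and> x2 < 1 \<and>
          maximizers p \<beta>1 \<beta>2 = {x1, x2} \<and>
          (\<lambda>n. d2psi p n \<beta>1 \<beta>2 / real n) \<longlonglongrightarrow>
            (x1 - x2)\<^sup>2 * sqrt (x1 * (1 - x1) * \<bar>ell'' p \<beta>1 \<beta>2 x1\<bar>)
                       * sqrt (x2 * (1 - x2) * \<bar>ell'' p \<beta>1 \<beta>2 x2\<bar>)
            / (sqrt (x1 * (1 - x1) * \<bar>ell'' p \<beta>1 \<beta>2 x1\<bar>)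
                + sqrt (x2 * (1 - x2) * \<bar>ell'' p \<beta>1 \<beta>2 x2\<bar>))\<^sup>2"
      using x xi by (intro exI[of _ x1] exI[of _ x2]) (simp add: s_def ell'' xc_def[OF p])
  }
  {
    assume crit: "(\<beta>1, \<beta>2) = (\<beta>1c p, \<beta>2c p)"
    define c where "c = real p ^ 5 / (24 * (real p - 1)\<^sup>2)"
    have c: "c > 0" using p by (simp add: c_def)
    have "(\<lambda>n. d2psi p n (\<beta>1c p) (\<beta>2c p) * real n / (scale 4 n)\<^sup>2)
        \<longlonglongrightarrow> power_exp_integral 4 c 2 / power_exp_integral 4 c 0"
      using ell_quartic[OF p] c by (intro d2psi_unique_maximizer[OF p critical_maximizers[OF p]]) (auto simp: c_def)
    also have "power_exp_integral 4 c 2 / power_exp_integral 4 c 0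
       = Gamma (3/4) / Gamma (1/4) * (2 * sqrt 6 * (real p - 1) / real p powr (5/2))"
    proof -
      have "power_exp_integral 4 c 2 / power_exp_integral 4 c 0 = Gamma (3/4) / Gamma (1/4) * (c powr (-3/4) / c powr (-1/4))"
        using c by (simp add: power_exp_integral_even mult.commute)
      \<comment> \<open>The exponents \<open>- (j + 1) / 4\<close> for \<open>j = 2\<close> and
        \<open>j = 0\<close> differ by a half, which brings in the square root of the quartic
        coefficient.\<close>
      also have "c powr (-3/4) / c powr (-1/4) = 1 / sqrt c"
      proof -
        have "c powr (-3/4) / c powr (-1/4) = c powr (- (1/2))"
          using powr_diff[of c "-3/4" "-1/4"] by simp
        also have "\<dots> = 1 / sqrt c"
          using c by (simp only: powr_minus_divide powr_half_sqrt less_imp_le)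
        finally show ?thesis .
      qed
      also have "1 / sqrt c = 2 * sqrt 6 * (real p - 1) / real p powr (5/2)"
      proof -
        have "sqrt (real p ^ 5) = real p powr (5/2)"
        proof -
          have "sqrt (real p ^ 5) = (real p powr 5) powr (1/2)"
            using p by (simp add: powr_half_sqrt)
          also have "\<dots> = real p powr (5/2)" by (rule powr_powr[THEN trans]) simp
          finally show ?thesis .
        qed
        moreover have "sqrt (24 * (real p - 1)\<^sup>2) = 2 * sqrt 6 * (real p - 1)"
        proof -
          have "24 * (real p - 1)\<^sup>2 = (2 * (real p - 1))\<^sup>2 * 6" by (simp add: power2_eq_square algebra_simps)
          then show ?thesis using p by (simp only: real_sqrt_mult real_sqrt_abs) simp
        qed
        ultimately show ?thesis by (simp add: c_def real_sqrt_divide)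
      qed
      finally show ?thesis .
    qed
    finally show "(\<lambda>n. d2psi p n \<beta>1 \<beta>2 / sqrt (real n)) \<longlonglongrightarrow>
         Gamma (3/4) / Gamma (1/4) * (2 * sqrt 6 * (real p - 1) / real p powr (5/2))"
    proof (elim Lim_transform_eventually, intro eventually_mono[OF ev])
      fix n :: nat assume n: "n > 0"
      \<comment> \<open>Squared fluctuations of order \<open>n powr (3/2)\<close>, divided by
        \<open>n\<close>, account for the growth like \<open>sqrt n\<close>.\<close>
      have "(scale 4 n)\<^sup>2 = real n powr (1 + 1/2)"
        using n by (simp add: scale_def power2_eq_square flip: powr_add)
      also have "\<dots> = real n * sqrt (real n)"
        using n by (simp only: powr_add powr_half_sqrt) simp
      finally show "d2psi p n (\<beta>1c p) (\<beta>2c p) * real n / (scale 4 n)\<^sup>2 = d2psi p n \<beta>1 \<beta>2 / sqrt (real n)"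
        using n crit by simp
    qed
  }
qed

end
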